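(* Let $\mathcal{C}=(S,\bar s,\mathbf{P})$ be a (possibly sub-stochastic) DTMC and $\mathcal{A}=(Q,S,\bar q,\delta,F)$ a UBA recognizing $\varphi$, with product matrix $\mathbf{B}$ having no non-accepting recurrent SCCs, accepting recurrent SCCs $\mathcal{D}^+$ and $D$-normalizers $\boldsymbol\mu_D$. Let $\lambda\in[0,1]$ and $S'\subseteq S$. The following are equivalent: (1) $\mathcal{C}_{S'}\models\mathbb{P}_{\ge\lambda}(\varphi)$, i.e. $\Pr_{\mathcal{C}_{S'},\bar s}(\varphi)\ge\lambda$; (2) there exists $\mathbf{x}\in[0,1]^{S\times Q}$ with $\mathbf{B}\mathbf{x}\ge\mathbf{x}$, $\boldsymbol\mu_D^\top\mathbf{x}_D\le1$ for each $D\in\mathcal{D}^+$, $\mathbf{x}(\bar s,\bar q)\ge\lambda$ and $\mathrm{stateSupp}(\mathbf{x})\subseteq S'$.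
   Context: A DTMC is $\mathcal{C}=(S,\bar s,\mathbf{P})$ with finite $S$, initial $\bar s$, $\mathbf{P}\in[0,1]^{S\times S}$ with row sums $\le1$; $\Pr_{\mathcal{C},s}$ is the (sub-)probability measure on infinite paths $s s_1\dots$ viewed as words over $S$. A Büchi automaton $\mathcal{A}=(Q,S,\bar q,\delta,F)$ has $\delta:Q\times S\to2^Q$; runs from $q$ on $w_0w_1\dots$ are $q_0q_1\dots$ with $q_0=q$, $q_{i+1}\in\delta(q_i,w_i)$, accepting if visiting $F$ infinitely often; $\mathcal{L}(\mathcal{A},q)$ is the set of words with an accepting run from $q$, $\varphi=\mathcal{L}(\mathcal{A},\bar q)$; UBA: every word has at most one accepting run. Value vector $\mathbf{v}(s,q)=\Pr_{\mathcal{C},s}(\mathcal{L}(\mathcal{A},q))$. $\mathbf{B}((s,q),(s',q'))=\mathbf{P}(s,s')$ if $q'\in\delta(q,s)$, else $0$. An SCC $D$ of $\mathbf{B}$ is recurrent if the spectral radius of the restriction $\mathbf{B}_D$ is $1$, accepting if it contains $(s,q)$ with $q\in F$; $\mathbf{x}_D$ is the restriction of $\mathbf{x}$ to $D$. A $D$-normalizer is $\boldsymbol\mu_D\in\mathbb{R}^D_{\ge0}$ with $\boldsymbol\mu_D^\top\mathbf{v}_D=1$. $\mathrm{stateSupp}(\mathbf{x})=\{s\mid\exists q.\mathbf{x}(s,q)>0\}$. $\mathcal{C}_{S'}$ has states $S$, initial $\bar s$, $\mathbf{P}'(s,s')=\mathbf{P}(s,s')$ if $s,s'\in S'$ and $0$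 otherwise.
   Formalization: Added assumption: every SCC of B all of whose automaton states have empty language has spectral radius at most 1 (automatic if all states of the UBA have nonempty language). Without it the claim fails, e.g. S={s}, P=1, Q={a,b}, δ total, F=∅, where x=1 satisfies (2) but Pr(φ)=0. *)

theory Defs
  imports "HOL-Probability.Probability" "Jordan_Normal_Form.Spectral_Radius"
begin

text \<open>Discrete-time Markov chains; the finite state space is the type \<open>'s\<close>.\<close>

record 's dtmc =
  dtmc_init :: 's
  dtmc_trans :: "'s \<Rightarrow> 's \<Rightarrow> real"

definition is_dtmc :: "'s::finite dtmc \<Rightarrow> bool" where
  "is_dtmc C \<longleftrightarrow>
     (\<forall>s s'. 0 \<le> dtmc_trans C s s' \<and> dtmc_trans C s s' \<le> 1) \<and>
     (\<forall>s. (\<Sum>s'\<in>UNIV. dtmc_trans C s s') \<le> 1)"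

definition restrict_dtmc :: "'s::finite dtmc \<Rightarrow> 's set \<Rightarrow> 's dtmc" where
  "restrict_dtmc C S' = C\<lparr>dtmc_trans := (\<lambda>s s'. if s \<in> S' \<and> s' \<in> S' then dtmc_trans C s s' else 0)\<rparr>"

text \<open>
  Sub-stochastic rows are completed by an absorbing state \<^term>\<open>None\<close> that receives the missing
  mass. The infinite paths of the chain are the trajectories that never reach \<^term>\<open>None\<close>, so
  the lost mass is not attributed to any word.
\<close>

definition step_pmf :: "'s::finite dtmc \<Rightarrow> 's option \<Rightarrow> 's option pmf" where
  "step_pmf C x = (case x of
       None \<Rightarrow> return_pmf None
     | Some s \<Rightarrow> embed_pmf (\<lambda>y. case y of
           None \<Rightarrow> 1 - (\<Sum>s'\<in>UNIV. dtmc_trans C s s')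
         | Some s' \<Rightarrow> dtmc_trans C s s'))"

lemma pmf_step_pmf:
  assumes "is_dtmc C"
  shows "pmf (step_pmf C (Some s)) (Some s') = dtmc_trans C s s'"
    and "pmf (step_pmf C (Some s)) None = 1 - (\<Sum>s'\<in>UNIV. dtmc_trans C s s')"
proof -
  define f where "f y = (case y of None \<Rightarrow> 1 - (\<Sum>s'\<in>UNIV. dtmc_trans C s s')
    | Some s' \<Rightarrow> dtmc_trans C s s')" for y
  have nonneg: "0 \<le> f y" for y
    using assms by (auto simp: f_def is_dtmc_def split: option.split)
  have "(\<Sum>y\<in>UNIV. f y) = 1"
    by (simp add: UNIV_option_conv sum.reindex f_def)
  then have "(\<integral>\<^sup>+ y. ennreal (f y) \<partial>count_space UNIV) = 1"
    using nonneg by (simp add: nn_integral_count_space_finite)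
  then have "pmf (embed_pmf f) y = f y" for y
    by (intro pmf_embed_pmf nonneg)
  then show "pmf (step_pmf C (Some s)) (Some s') = dtmc_trans C s s'"
    and "pmf (step_pmf C (Some s)) None = 1 - (\<Sum>s'\<in>UNIV. dtmc_trans C s s')"
    by (simp_all add: step_pmf_def f_def[abs_def])
qed

text \<open>
  \<open>path_kernel C s n \<omega>\<close> is the law of the state at time \<open>n\<close> given the states \<open>\<omega> 0, \<dots>, \<omega> (n - 1)\<close>.
\<close>

definition path_kernel ::
  "'s::finite dtmc \<Rightarrow> 's \<Rightarrow> nat \<Rightarrow> (nat \<Rightarrow> 's option) \<Rightarrow> 's option measure" where
  "path_kernel C s n \<omega> = (case n of
       0 \<Rightarrow> measure_pmf (return_pmf (Some s))
     | Suc m \<Rightarrow> measure_pmf (step_pmf C (\<omega> m)))"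

lemma Ionescu_Tulcea_path_kernel:
  fixes C :: "'a::finite dtmc"
  shows "Ionescu_Tulcea (path_kernel C s) (\<lambda>_. count_space UNIV)"
proof (rule Ionescu_Tulcea.intro)
  fix i :: nat
  show "path_kernel C s i \<in>
    measurable (PiM {0..<i} (\<lambda>_. count_space UNIV)) (subprob_algebra (count_space UNIV))"
  proof (cases i)
    case 0
    then show ?thesis
      by (auto simp: path_kernel_def[abs_def] space_subprob_algebra prob_space_imp_subprob_space
          measure_pmf.prob_space_axioms intro!: measurable_const)
  next
    case (Suc m)
    have "(\<lambda>\<omega>. \<omega> m) \<in>
      measurable (PiM {0..<Suc m} (\<lambda>_. count_space UNIV)) (count_space (UNIV :: 'a option set))"
      by (rule measurable_component_singleton) simp
    moreover have "(\<lambda>x. measure_pmf (step_pmf C x)) \<in>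
      measurable (count_space UNIV) (subprob_algebra (count_space UNIV))"
      by (simp add: space_subprob_algebra prob_space_imp_subprob_space
          measure_pmf.prob_space_axioms)
    ultimately have "(\<lambda>\<omega>. measure_pmf (step_pmf C (\<omega> m))) \<in>
      measurable (PiM {0..<Suc m} (\<lambda>_. count_space UNIV)) (subprob_algebra (count_space UNIV))"
      by (rule measurable_compose)
    then show ?thesis
      using Suc by (simp add: path_kernel_def[abs_def])
  qed
next
  fix i :: nat and x :: "nat \<Rightarrow> 'a option"
  show "prob_space (path_kernel C s i x)"
    by (auto simp: path_kernel_def measure_pmf.prob_space_axioms split: nat.split)
qed

text \<open>The law of the completed chain started in \<open>s\<close>, i.e. the Ionescu-Tulcea projective limit.\<close>

definition path_measure :: "'s::finite dtmc \<Rightarrow> 's \<Rightarrow> (nat \<Rightarrow> 's option) measure" where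
  "path_measure C s = projective_family.lim UNIV
     (Ionescu_Tulcea.CI (path_kernel C s) (\<lambda>_. count_space UNIV)) (\<lambda>_. count_space UNIV)"

definition path_prob :: "'s::finite dtmc \<Rightarrow> 's \<Rightarrow> (nat \<Rightarrow> 's) set \<Rightarrow> real" where
  "path_prob C s L = measure (path_measure C s) ((\<lambda>w. Some \<circ> w) ` L)"

definition satisfies_prob_ge :: "'s::finite dtmc \<Rightarrow> real \<Rightarrow> (nat \<Rightarrow> 's) set \<Rightarrow> bool" where
  "satisfies_prob_ge C \<theta> \<phi> \<longleftrightarrow> path_prob C (dtmc_init C) \<phi> \<ge> \<theta>"

text \<open>Buchi automata over the alphabet \<open>'s\<close>.\<close>

record ('q, 's) buchi =
  buchi_init :: 'q
  buchi_delta :: "'q \<Rightarrow> 's \<Rightarrow> 'q set"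
  buchi_acc :: "'q set"

definition accepting_run :: "('q, 's) buchi \<Rightarrow> 'q \<Rightarrow> (nat \<Rightarrow> 's) \<Rightarrow> (nat \<Rightarrow> 'q) \<Rightarrow> bool" where
  "accepting_run A q w r \<longleftrightarrow>
     r 0 = q \<and> (\<forall>i. r (Suc i) \<in> buchi_delta A (r i) (w i)) \<and> (\<exists>\<^sub>\<infinity>i. r i \<in> buchi_acc A)"

definition language :: "('q, 's) buchi \<Rightarrow> 'q \<Rightarrow> (nat \<Rightarrow> 's) set" where
  "language A q = {w. \<exists>r. accepting_run A q w r}"

definition unambiguous :: "('q, 's) buchi \<Rightarrow> bool" where
  "unambiguous A \<longleftrightarrow>
     (\<forall>w r r'. accepting_run A (buchi_init A) w r \<and> accepting_run A (buchi_init A) w r' \<longrightarrow> r = r')"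

definition value_vec :: "'s::finite dtmc \<Rightarrow> ('q, 's) buchi \<Rightarrow> 's \<times> 'q \<Rightarrow> real" where
  "value_vec C A = (\<lambda>(s, q). path_prob C s (language A q))"

definition product_matrix ::
  "'s::finite dtmc \<Rightarrow> ('q, 's) buchi \<Rightarrow> 's \<times> 'q \<Rightarrow> 's \<times> 'q \<Rightarrow> real" where
  "product_matrix C A =
     (\<lambda>(s, q) (s', q'). if q' \<in> buchi_delta A q s then dtmc_trans C s s' else 0)"

definition edges :: "('i \<Rightarrow> 'i \<Rightarrow> real) \<Rightarrow> ('i \<times> 'i) set" where
  "edges B = {(i, j). B i j > 0}"

definition sccs :: "('i \<Rightarrow> 'i \<Rightarrow> real) \<Rightarrow> 'i set set" where
  "sccs B = {D. \<exists>i. D = {j. (i, j) \<in> (edges B)\<^sup>* \<and> (j, i) \<in> (edges B)\<^sup>*}}"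

text \<open>
  \<open>from_nat_into D\<close> enumerates the finite set \<open>D\<close> without repetition on \<open>{..<card D}\<close>; the spectral
  radius does not depend on the enumeration.
\<close>

definition submatrix_on :: "('i \<Rightarrow> 'i \<Rightarrow> real) \<Rightarrow> 'i set \<Rightarrow> complex mat" where
  "submatrix_on B D = mat (card D) (card D)
     (\<lambda>(i, j). complex_of_real (B (from_nat_into D i) (from_nat_into D j)))"

definition recurrent_sccs :: "('i \<Rightarrow> 'i \<Rightarrow> real) \<Rightarrow> 'i set set" where
  "recurrent_sccs B = {D \<in> sccs B. spectral_radius (submatrix_on B D) = 1}"

definition accepting_set :: "('q, 's) buchi \<Rightarrow> ('s \<times> 'q) set \<Rightarrow> bool" where
  "accepting_set A D \<longleftrightarrow> (\<exists>(s, q)\<in>D. q \<in> buchi_acc A)"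

definition normalizer ::
  "'s::finite dtmc \<Rightarrow> ('q::finite, 's) buchi \<Rightarrow> ('s \<times> 'q) set \<Rightarrow> ('s \<times> 'q \<Rightarrow> real) \<Rightarrow> bool" where
  "normalizer C A D \<mu> \<longleftrightarrow> (\<forall>p\<in>D. 0 \<le> \<mu> p) \<and> (\<Sum>p\<in>D. \<mu> p * value_vec C A p) = 1"

definition state_supp :: "('s \<times> 'q \<Rightarrow> real) \<Rightarrow> 's set" where
  "state_supp x = {s. \<exists>q. x (s, q) > 0}"

end

theory Submission
  imports Defs "HOL-Library.Ramsey"
begin

text \<open>
  The value of the restricted chain is \<open>v'(s, q)\<close>, the probability in \<open>C\<close> of the words of \<open>L(q)\<close> that
  stay in \<open>S'\<close>. It satisfies \<open>B v' \<ge> v'\<close> and \<open>v' \<le> v\<close>, so it witnesses (2) whenever (1) holds.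

  Conversely let \<open>x\<close> be as in (2). Unambiguity gives \<open>v' = B v'\<close> on the states over \<open>S'\<close> reachable from
  the initial one, so \<open>y = max(x - v', 0)\<close> satisfies \<open>B y \<ge> y\<close> there. If \<open>y\<close> is nonzero, take an SCC \<open>D\<close>
  that is minimal among those meeting its support. Then \<open>B\<^sub>D y\<^sub>D \<ge> y\<^sub>D\<close>, which forces spectral radius \<open>1\<close>,
  as unambiguity bounds the powers of \<open>B\<^sub>D\<close>. Hence \<open>D\<close> is recurrent, the normalizer shows \<open>v > 0\<close> on \<open>D\<close>,
  and irreducibility gives \<open>y = c v\<close> with \<open>c > 0\<close> and \<open>B\<^sub>D v\<^sub>D = v\<^sub>D\<close>. So almost all accepted words are
  accepted inside \<open>D\<close>, which lies over \<open>S'\<close>; thus \<open>v' = v\<close> on \<open>D\<close>, and the normalizer maps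
  \<open>x\<^sub>D = (1 + c) v\<^sub>D\<close> to \<open>1 + c > 1\<close>.
\<close>

section \<open>Irreducible nonnegative matrices and the spectral radius\<close>

text \<open>Unambiguity restrains only runs that extend to accepting ones. Where no word is
  accepted, branching is free: for one chain state looping with probability 1 inside
  \<open>S'\<close>, two automaton states that are always both successors, and no accepting states,
  \<open>B\<close> has spectral radius 2, and the constant vector 1 meets all constraints of (2)
  although the value is 0. Hence SCCs with empty languages are controlled by a hypothesis, while on
  the others an accepted word is needed to complete finite runs before unambiguity can bound the
  powers of \<open>B\<close>. Likewise v' = B v' is available only where unambiguity is inherited
  from the initial state; subadditivity gives v' <= B v' everywhere, which is all the witness needs.
  The second obstacle is measurability. \<open>measure\<close> is 0 off the sigma-algebra, and
  \<open>language\<close> quantifies over uncountably many runs. Ramsey's theorem sorts the words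
  into finitely many types that determine acceptance and are defined by conditions on finite
  prefixes.\<close>

definition restr_op :: "('i \<Rightarrow> 'i \<Rightarrow> real) \<Rightarrow> 'i set \<Rightarrow> ('i \<Rightarrow> real) \<Rightarrow> 'i \<Rightarrow> real" where
  "restr_op B D f p = (\<Sum>p'\<in>D. B p p' * f p')"

lemma restr_op_mono:
  assumes "\<And>p p'. 0 \<le> B p p'" and "\<And>p. p \<in> D \<Longrightarrow> f p \<le> g p"
  shows "restr_op B D f p \<le> restr_op B D g p"
  unfolding restr_op_def by (intro sum_mono mult_left_mono assms)

lemma restr_op_cong: "(\<And>p. p \<in> D \<Longrightarrow> f p = g p) \<Longrightarrow> restr_op B D f = restr_op B D g"
  by (simp add: restr_op_def fun_eq_iff)

lemma restr_op_funpow_sum: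
  assumes "finite D" "finite J"
  shows "(restr_op B D ^^ k) (\<lambda>p. \<Sum>j\<in>J. c j * h j p) = (\<lambda>p. \<Sum>j\<in>J. c j * (restr_op B D ^^ k) (h j) p)"
proof (induction k)
  case (Suc k)
  have "restr_op B D (\<lambda>p. \<Sum>j\<in>J. c j * g j p) p = (\<Sum>j\<in>J. c j * restr_op B D (g j) p)" for g p
    unfolding restr_op_def sum_distrib_left
    by (subst sum.swap) (simp add: mult.left_commute)
  then show ?case
    by (simp add: Suc.IH fun_eq_iff)
qed simp

text \<open>Both bounds on the spectral radius rest on this: geometric growth of the iterates
  contradicts bounded powers.\<close>

lemma restr_op_funpow_ge:
  assumes "\<And>p p'. 0 \<le> B p p'" and "0 \<le> c"
    and "\<And>p. p \<in> D \<Longrightarrow> c * f p \<le> restr_op B D f p"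
  shows "p \<in> D \<Longrightarrow> c ^ k * f p \<le> (restr_op B D ^^ k) f p"
proof (induction k arbitrary: p)
  case (Suc k)
  have "c ^ Suc k * f p \<le> c ^ k * restr_op B D f p"
    using mult_left_mono[OF assms(3)[OF Suc.prems], of "c ^ k"] assms(2) by (simp add: mult.assoc mult.left_commute)
  also have "\<dots> = restr_op B D (\<lambda>p. c ^ k * f p) p"
    by (simp add: restr_op_def sum_distrib_left mult.left_commute)
  also have "\<dots> \<le> restr_op B D ((restr_op B D ^^ k) f) p"
    using Suc.IH by (intro restr_op_mono assms)
  finally show ?case by simp
qed simp

text \<open>Each intermediate point of a path from \<open>p\<close> to \<open>p'\<close> lies on a
  cycle through \<open>p\<close>, so the path never leaves the SCC. This is irreducibility in a form
  that \<open>restr_op B D\<close> can follow edge by edge.\<close>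

lemma rtrancl_scc:
  assumes "D \<in> sccs B" "p \<in> D" "p' \<in> D"
  shows "(p, p') \<in> (edges B \<inter> D \<times> D)\<^sup>*"
proof -
  obtain i where D: "D = {j. (i, j) \<in> (edges B)\<^sup>* \<and> (j, i) \<in> (edges B)\<^sup>*}"
    using assms(1) by (auto simp: sccs_def)
  have "(p, p') \<in> (edges B)\<^sup>*"
    using assms(2,3) by (auto simp: D intro: rtrancl_trans)
  moreover have "(p', p) \<in> (edges B)\<^sup>*"
    using assms(2,3) by (auto simp: D intro: rtrancl_trans)
  ultimately show ?thesis
  proof (induction rule: rtrancl_induct)
    case (step x z)
    have "(x, p) \<in> (edges B)\<^sup>*"
      using step.hyps(2) step.prems by (rule converse_rtrancl_into_rtrancl)
    then have "(p, x) \<in> (edges B \<inter> D \<times> D)\<^sup>*"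
      by (rule step.IH)
    moreover have "(i, x) \<in> (edges B)\<^sup>*" "(i, z) \<in> (edges B)\<^sup>*" "(x, i) \<in> (edges B)\<^sup>*" "(z, i) \<in> (edges B)\<^sup>*"
      using assms(2) step \<open>(x, p) \<in> _\<close> unfolding D by (blast intro: rtrancl_trans rtrancl_into_rtrancl)+
    then have "(x, z) \<in> edges B \<inter> D \<times> D"
      using step.hyps(2) by (simp add: D)
    ultimately show ?case
      by (rule rtrancl_into_rtrancl)
  qed simp
qed

text \<open>Positivity travels backwards along an edge from \<open>x\<close> to \<open>z\<close>,
  because \<open>v x\<close> dominates the single term \<open>B x z * v z\<close>.\<close>

lemma positive_on_scc:
  assumes D: "finite D" "D \<in> sccs B" and nonneg: "\<And>p p'. 0 \<le> B p p'"
    and v: "\<And>p. p \<in> D \<Longrightarrow> 0 \<le> v p" "\<And>p. p \<in> D \<Longrightarrow> restr_op B D v p \<le> v p"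
    and pos: "p\<^sub>0 \<in> D" "0 < v p\<^sub>0" and p: "p \<in> D"
  shows "0 < v p"
  using rtrancl_scc[OF D(2) p pos(1)]
proof (induction rule: converse_rtrancl_induct)
  case (step x z)
  then have "0 < B x z * v z"
    by (auto simp: edges_def)
  also have "\<dots> \<le> restr_op B D v x"
    unfolding restr_op_def using step D(1) nonneg v(1) by (intro member_le_sum) auto
  also have "\<dots> \<le> v x"
    using step by (intro v(2)) auto
  finally show ?case .
qed (use pos in simp)

text \<open>
  A substitute for uniqueness of the Perron vector: \<open>c v - y\<close> with \<open>c = max (y / v)\<close> is nonnegative,
  satisfies \<open>B\<^sub>D (c v - y) \<le> c v - y\<close> and has a zero, hence vanishes by irreducibility.
\<close>

lemma sub_super_invariant_proportional:
  assumes D: "finite D" "D \<in> sccs B" and nonneg: "\<And>p p'. 0 \<le> B p p'"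
    and v: "\<And>p. p \<in> D \<Longrightarrow> 0 < v p" "\<And>p. p \<in> D \<Longrightarrow> restr_op B D v p \<le> v p"
    and y: "\<And>p. p \<in> D \<Longrightarrow> y p \<le> restr_op B D y p"
    and pos: "p\<^sub>0 \<in> D" "0 < y p\<^sub>0"
  obtains c where "0 < c" "\<And>p. p \<in> D \<Longrightarrow> y p = c * v p" "\<And>p. p \<in> D \<Longrightarrow> restr_op B D v p = v p"
proof -
  define c where "c = Max ((\<lambda>p. y p / v p) ` D)"
  have le: "y p / v p \<le> c" if "p \<in> D" for p
    using that D(1) by (simp add: c_def)
  have "0 < y p\<^sub>0 / v p\<^sub>0"
    using pos v(1) by simp
  with le[OF pos(1)] have c: "0 < c"
    by linarith
  obtain p\<^sub>1 where p\<^sub>1: "p\<^sub>1 \<in> D" "y p\<^sub>1 / v p\<^sub>1 = c"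
    using Max_in[of "(\<lambda>p. y p / v p) ` D"] D(1) pos(1) by (fastforce simp: c_def)
  define w where "w p = c * v p - y p" for p
  have w_nonneg: "0 \<le> w p" if "p \<in> D" for p
    using le[OF that] v(1)[OF that] by (simp add: w_def field_simps)
  have op_w: "restr_op B D w p = c * restr_op B D v p - restr_op B D y p" for p
    by (simp add: restr_op_def w_def algebra_simps sum_subtractf sum_distrib_left)
  have op_w_le: "restr_op B D w p \<le> w p" if "p \<in> D" for p
    using y[OF that] mult_left_mono[OF v(2)[OF that] less_imp_le[OF c]] unfolding op_w by (simp add: w_def)
  have w: "w p = 0" if "p \<in> D" for p
  proof (rule ccontr)
    assume "w p \<noteq> 0"
    with w_nonneg[OF that] have "0 < w p"
      by simp
    from positive_on_scc[OF D nonneg w_nonneg op_w_le that this p\<^sub>1(1)] v(1)[OF p\<^sub>1(1)] p\<^sub>1(2)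
    show False
      by (auto simp: w_def field_simps)
  qed
  show ?thesis
  proof
    fix p assume p: "p \<in> D"
    show "y p = c * v p"
      using w[OF p] by (simp add: w_def)
    have "restr_op B D w p = 0"
      using w by (simp add: restr_op_def)
    then have "c * v p \<le> c * restr_op B D v p"
      using y[OF p] w[OF p] unfolding op_w by (simp add: w_def)
    with c v(2)[OF p] show "restr_op B D v p = v p"
      by simp
  qed (rule c)
qed

section \<open>Spectral radius and growth of powers\<close>

lemma submatrix_on_mult_vec:
  assumes "finite D" "i < card D"
  shows "vec_index (submatrix_on B D *\<^sub>v vec (card D) (\<lambda>j. f (from_nat_into D j))) i =
    (\<Sum>p'\<in>D. complex_of_real (B (from_nat_into D i) p') * f p')"
proof -
  have "vec_index (submatrix_on B D *\<^sub>v vec (card D) (\<lambda>j. f (from_nat_into D j))) i =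
    (\<Sum>j<card D. complex_of_real (B (from_nat_into D i) (from_nat_into D j)) * f (from_nat_into D j))"
    using assms(2) by (auto simp: submatrix_on_def scalar_prod_def lessThan_atLeast0)
  also have "\<dots> = (\<Sum>p'\<in>D. complex_of_real (B (from_nat_into D i) p') * f p')"
    by (rule sum.reindex_bij_betw[OF bij_betw_from_nat_into_finite[OF assms(1)]])
  finally show ?thesis .
qed

lemma submatrix_on_carrier: "submatrix_on B D \<in> carrier_mat (card D) (card D)"
  by (simp add: submatrix_on_def)

lemma submatrix_on_mult_vec_of_real:
  assumes "finite D"
  shows "submatrix_on B D *\<^sub>v vec (card D) (\<lambda>j. complex_of_real (f (from_nat_into D j))) =
    vec (card D) (\<lambda>j. complex_of_real (restr_op B D f (from_nat_into D j)))"
  using submatrix_on_mult_vec[OF assms, of _ B "\<lambda>p. complex_of_real (f p)"] submatrix_on_carrier[of B D]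
  by (intro eq_vecI) (auto simp: restr_op_def)

lemma submatrix_on_pow_mult_vec:
  assumes "finite D"
  shows "submatrix_on B D ^\<^sub>m k *\<^sub>v vec (card D) (\<lambda>j. complex_of_real (f (from_nat_into D j))) =
    vec (card D) (\<lambda>j. complex_of_real ((restr_op B D ^^ k) f (from_nat_into D j)))"
proof (induction k arbitrary: f)
  case 0
  have "vec (card D) g \<in> carrier_vec (dim_row (submatrix_on B D))" for g :: "nat \<Rightarrow> complex"
    using submatrix_on_carrier[of B D] by auto
  then show ?case by simp
next
  case (Suc k)
  have "submatrix_on B D ^\<^sub>m Suc k *\<^sub>v vec (card D) (\<lambda>j. complex_of_real (f (from_nat_into D j))) =
    submatrix_on B D ^\<^sub>m k *\<^sub>v (submatrix_on B D *\<^sub>v vec (card D) (\<lambda>j. complex_of_real (f (from_nat_into D j))))"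
    unfolding pow_mat.simps
    by (rule assoc_mult_mat_vec[of _ "card D" "card D" _ "card D"])
      (auto intro: pow_carrier_mat submatrix_on_carrier)
  also have "\<dots> = vec (card D) (\<lambda>j. complex_of_real ((restr_op B D ^^ k) (restr_op B D f) (from_nat_into D j)))"
    unfolding submatrix_on_mult_vec_of_real[OF assms] by (rule Suc.IH)
  finally show ?case
    by (simp only: funpow_Suc_right comp_apply)
qed

text \<open>Every eigenvalue of the scaled matrix is \<open>t\<close> times one of the original.
  This gives room to enlarge \<open>B\<close> by a factor above 1 while the radius stays below
  1.\<close>

lemma scaled_spectral_radius_less_1:
  assumes "D \<noteq> {}" "finite D" "0 < t" "t * spectral_radius (submatrix_on B D) < 1"
  shows "spectral_radius (submatrix_on (\<lambda>p p'. t * B p p') D) < 1"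
proof -
  let ?A = "submatrix_on B D" and ?A' = "submatrix_on (\<lambda>p p'. t * B p p') D"
  have n: "0 < card D"
    using assms by (simp add: card_gt_0_iff)
  have A': "?A' = complex_of_real t \<cdot>\<^sub>m ?A"
    by (intro eq_matI) (auto simp: submatrix_on_def)
  obtain k where k: "eigenvalue ?A' k" "spectral_radius ?A' = norm k"
    using spectral_radius_mem_max(1)[OF submatrix_on_carrier n] by (auto simp: spectrum_def)
  then obtain u where u: "eigenvector ?A' u k"
    by (auto simp: eigenvalue_def)
  have d: "dim_row ?A = card D" "dim_row ?A' = card D" "dim_col ?A = card D" "dim_vec u = card D"
    using u by (auto simp: eigenvector_def submatrix_on_def)
  have "?A *\<^sub>v u = (k / complex_of_real t) \<cdot>\<^sub>v u"
  proof (rule eq_vecI)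
    fix i assume "i < dim_vec ((k / complex_of_real t) \<cdot>\<^sub>v u)"
    then have i: "i < card D"
      using d by simp
    have "vec_index (?A' *\<^sub>v u) i = complex_of_real t * vec_index (?A *\<^sub>v u) i"
      using i d unfolding A' by (simp add: scalar_prod_def sum_distrib_left mult.assoc)
    moreover have "vec_index (?A' *\<^sub>v u) i = k * vec_index u i"
    proof -
      have "vec_index (k \<cdot>\<^sub>v u) i = k * vec_index u i"
        using i d by simp
      then show ?thesis
        using u by (simp add: eigenvector_def)
    qed
    ultimately show "vec_index (?A *\<^sub>v u) i = vec_index ((k / complex_of_real t) \<cdot>\<^sub>v u) i"
      using i d assms(3) by (simp add: field_simps)
  qed (use d in simp)
  then have "eigenvector ?A u (k / complex_of_real t)"
    using u d by (simp add: eigenvector_def)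
  then have "norm (k / complex_of_real t) \<le> spectral_radius ?A"
    by (intro spectral_radius_mem_max(2)[OF submatrix_on_carrier n] imageI)
      (auto simp: spectrum_def eigenvalue_def)
  with assms(3) have "norm k \<le> t * spectral_radius ?A"
    by (simp add: norm_divide field_simps)
  with assms(4) k(2) show ?thesis
    by simp
qed

text \<open>A radius below 1 bounds the powers, but \<open>y <= B y\<close> alone yields no growth
  to contradict this. So \<open>B\<close> is first scaled by some \<open>t > 1\<close> that keeps
  the radius below 1: the scaled powers are still bounded, yet enlarge \<open>y\<close> by at least
  \<open>t ^ k\<close>.\<close>

lemma spectral_radius_ge_1:
  assumes D: "finite D" and nonneg: "\<And>p p'. 0 \<le> B p p'"
    and y: "\<And>p. p \<in> D \<Longrightarrow> y p \<le> restr_op B D y p" and p: "p \<in> D" "0 < y p"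
  shows "1 \<le> spectral_radius (submatrix_on B D)"
proof (rule ccontr)
  let ?\<rho> = "spectral_radius (submatrix_on B D)"
  assume "\<not> 1 \<le> ?\<rho>"
  then have lt: "?\<rho> < 1"
    by simp
  have ne: "D \<noteq> {}" and n: "0 < card D"
    using p D by (auto simp: card_gt_0_iff)
  have "0 \<le> ?\<rho>"
    using spectral_radius_mem_max(1)[OF submatrix_on_carrier n, of B] by auto
  \<comment> \<open>The reciprocal of the midpoint between the radius and 1.\<close>
  define t where "t = 2 / (1 + ?\<rho>)"
  have t: "1 < t" "t * ?\<rho> < 1"
    using lt \<open>0 \<le> ?\<rho>\<close> by (auto simp: t_def field_simps)
  let ?B = "\<lambda>p p'. t * B p p'"
  let ?A = "submatrix_on ?B D" and ?Y = "vec (card D) (\<lambda>j. complex_of_real (y (from_nat_into D j)))"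
  have "spectral_radius ?A < 1"
    using t by (intro scaled_spectral_radius_less_1 ne D) auto
  from spectral_radius_jnf_norm_bound_less_1_upper_triangular[OF submatrix_on_carrier this]
  obtain c where c: "\<And>k. norm_bound (?A ^\<^sub>m k) c"
    by auto
  have "p \<in> from_nat_into D ` {..<card D}"
    using bij_betw_from_nat_into_finite[OF D] p(1) by (simp add: bij_betw_def)
  then obtain i where i: "i < card D" "from_nat_into D i = p"
    by auto
  define K where "K = (\<Sum>j<card D. c * norm (y (from_nat_into D j)))"
  have bound: "t ^ k * y p \<le> K" for k
  proof -
    have Ak: "?A ^\<^sub>m k \<in> carrier_mat (card D) (card D)"
      by (intro pow_carrier_mat submatrix_on_carrier)
    have "t ^ k * y p \<le> (restr_op ?B D ^^ k) y p"
    proof (rule restr_op_funpow_ge)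
      show "t * y p \<le> restr_op ?B D y p" if "p \<in> D" for p
        using mult_left_mono[OF y[OF that], of t] t
        by (simp add: restr_op_def sum_distrib_left mult.assoc)
    qed (use nonneg t p in auto)
    also have "\<dots> \<le> norm (vec_index (?A ^\<^sub>m k *\<^sub>v ?Y) i)"
      unfolding submatrix_on_pow_mult_vec[OF D] using i by simp
    also have "vec_index (?A ^\<^sub>m k *\<^sub>v ?Y) i = (\<Sum>j<card D. (?A ^\<^sub>m k) $$ (i, j) * complex_of_real (y (from_nat_into D j)))"
      using i carrier_matD[OF Ak] by (simp add: scalar_prod_def lessThan_atLeast0)
    also have "norm \<dots> \<le> (\<Sum>j<card D. norm ((?A ^\<^sub>m k) $$ (i, j)) * norm (y (from_nat_into D j)))"
      by (rule order_trans[OF norm_sum]) (simp add: norm_mult)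
    also have "\<dots> \<le> K"
      unfolding K_def using c[of k, unfolded norm_bound_def carrier_matD[OF Ak]] i by (intro sum_mono mult_right_mono) auto
    finally show ?thesis .
  qed
  obtain k where "K / y p < t ^ k"
    using real_arch_pow[OF t(1)] by blast
  with bound[of k] p(2) show False
    by (simp add: field_simps)
qed

text \<open>By the triangle inequality the moduli \<open>g\<close> of an eigenvector for
  \<open>e\<close> satisfy \<open>norm e * g <= B g\<close> on \<open>D\<close>. For
  \<open>norm e > 1\<close> the iterates then grow geometrically, although
  \<open>(restr_op B D ^^ k) (indicator {p'}) p\<close>, the entry of the power at \<open>p\<close>
  and \<open>p'\<close>, never exceeds 1.\<close>

lemma spectral_radius_le_1:
  assumes D: "finite D" "D \<noteq> {}" and nonneg: "\<And>p p'. 0 \<le> B p p'"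
    and bound: "\<And>k p p'. p \<in> D \<Longrightarrow> p' \<in> D \<Longrightarrow> (restr_op B D ^^ k) (indicator {p'}) p \<le> 1"
  shows "spectral_radius (submatrix_on B D) \<le> 1"
proof (rule ccontr)
  let ?A = "submatrix_on B D"
  have n: "0 < card D"
    using D by (simp add: card_gt_0_iff)
  assume "\<not> spectral_radius ?A \<le> 1"
  then obtain e u where ev: "eigenvector ?A u e" and e: "1 < norm e"
    using spectral_radius_mem_max(1)[OF submatrix_on_carrier n, of B]
    by (auto simp: spectrum_def eigenvalue_def)
  have d: "dim_vec u = card D"
    using ev by (auto simp: eigenvector_def submatrix_on_def)
  have bij: "bij_betw (from_nat_into D) {..<card D} D"
    using D(1) by (rule bij_betw_from_nat_into_finite)
  define h where "h p = vec_index u (inv_into {..<card D} (from_nat_into D) p)" for p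
  have h: "h (from_nat_into D j) = vec_index u j" if "j < card D" for j
    using that bij by (simp add: h_def bij_betw_def)
  have u: "u = vec (card D) (\<lambda>j. h (from_nat_into D j))"
    using d h by (intro eq_vecI) auto
  obtain i where i: "i < card D" "vec_index u i \<noteq> 0"
    using ev d by (auto simp: eigenvector_def vec_eq_iff submatrix_on_def)
  define p where "p = from_nat_into D i"
  have p: "p \<in> D" "h p \<noteq> 0"
    using i bij h by (auto simp: p_def bij_betw_def)
  have eq: "(\<Sum>p'\<in>D. complex_of_real (B p p') * h p') = e * h p" if "p \<in> D" for p
  proof -
    have "p \<in> from_nat_into D ` {..<card D}"
      using that bij by (simp add: bij_betw_def)
    then obtain j where j: "j < card D" "p = from_nat_into D j"
      by (elim imageE) auto
    have "vec_index (?A *\<^sub>v u) j = (\<Sum>p'\<in>D. complex_of_real (B p p') * h p')"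
      unfolding j(2) by (subst u) (rule submatrix_on_mult_vec[OF D(1) j(1)])
    moreover have "?A *\<^sub>v u = e \<cdot>\<^sub>v u"
      using ev by (simp add: eigenvector_def)
    ultimately show ?thesis
      using j d h by simp
  qed
  define g where "g p = norm (h p)" for p
  have "norm e * g p \<le> restr_op B D g p" if "p \<in> D" for p
  proof -
    have "norm e * g p = norm (\<Sum>p'\<in>D. complex_of_real (B p p') * h p')"
      unfolding eq[OF that] by (simp add: g_def norm_mult)
    also have "\<dots> \<le> restr_op B D g p"
      unfolding restr_op_def
      by (rule order_trans[OF norm_sum]) (simp add: norm_mult g_def nonneg)
    finally show ?thesis .
  qed
  then have lower: "norm e ^ k * g p \<le> (restr_op B D ^^ k) g p" for k
    using p by (intro restr_op_funpow_ge nonneg) auto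
  \<comment> \<open>\<open>0 < k\<close> because \<open>g\<close> and its expansion into indicators
    agree only on \<open>D\<close>. They have the same image under \<open>restr_op B D\<close>,
    which reads only arguments in \<open>D\<close>.\<close>
  have upper: "(restr_op B D ^^ k) g p \<le> (\<Sum>p'\<in>D. g p')" if "0 < k" for k
  proof -
    have "restr_op B D g = restr_op B D (\<lambda>p. \<Sum>p'\<in>D. g p' * indicator {p'} p)"
      using D(1) by (intro restr_op_cong) (simp add: indicator_def if_distrib cong: if_cong)
    then have "(restr_op B D ^^ k) g = (restr_op B D ^^ k) (\<lambda>p. \<Sum>p'\<in>D. g p' * indicator {p'} p)"
      using that by (cases k) (simp_all only: funpow_Suc_right comp_apply)
    also have "\<dots> = (\<lambda>p. \<Sum>p'\<in>D. g p' * (restr_op B D ^^ k) (indicator {p'}) p)"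
      using D(1) by (intro restr_op_funpow_sum)
    finally have "(restr_op B D ^^ k) g p = (\<Sum>p'\<in>D. g p' * (restr_op B D ^^ k) (indicator {p'}) p)"
      by simp
    also have "\<dots> \<le> (\<Sum>p'\<in>D. g p' * 1)"
      using bound p(1) by (intro sum_mono mult_left_mono) (auto simp: g_def)
    finally show ?thesis
      by simp
  qed
  have "0 < g p"
    using p by (simp add: g_def)
  obtain k where k: "(\<Sum>p'\<in>D. g p') / g p < norm e ^ k"
    using real_arch_pow[OF e] by blast
  also have "\<dots> \<le> norm e ^ Suc k"
    using e by (intro power_increasing) auto
  finally have "(\<Sum>p'\<in>D. g p') < norm e ^ Suc k * g p"
    using \<open>0 < g p\<close> by (simp add: field_simps)
  with lower[of "Suc k"] upper[of "Suc k"] show False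
    by simp
qed

section \<open>Measurability of Buchi languages\<close>

abbreviation word_space :: "(nat \<Rightarrow> 'a) measure" where
  "word_space \<equiv> PiM UNIV (\<lambda>_. count_space UNIV)"

lemma space_word_space: "space word_space = UNIV"
  by (simp add: space_PiM)

section \<open>Events determined by a finite prefix\<close>

lemma sets_prefix_cylinder:
  fixes a :: "nat \<Rightarrow> 'a"
  shows "{w. \<forall>k<n. w k = a k} \<in> sets word_space"
proof -
  have "{w \<in> space word_space. \<forall>k<n. w k = a k} \<in> sets (word_space :: (nat \<Rightarrow> 'a) measure)"
    by measurable
  then show ?thesis
    by (simp add: space_word_space)
qed

text \<open>Indexing the cylinders by lists of length \<open>n\<close> instead of infinite words
  makes them pairwise disjoint and, over a countable alphabet, countable in number.\<close>

lemma finite_prefix_eq_UN: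
  assumes "\<And>w w'. (\<And>k. k < n \<Longrightarrow> w k = w' k) \<Longrightarrow> P w = P w'"
  shows "{w. P w} = (\<Union>u\<in>{u. \<exists>w. P w \<and> u = map w [0..<n]}. {w. \<forall>k<n. w k = u ! k})"
proof (intro Set.set_eqI iffI)
  fix w assume "w \<in> {w. P w}"
  then show "w \<in> (\<Union>u\<in>{u. \<exists>w. P w \<and> u = map w [0..<n]}. {w. \<forall>k<n. w k = u ! k})"
    by (intro UN_I[of "map w [0..<n]"]) auto
next
  fix w assume "w \<in> (\<Union>u\<in>{u. \<exists>w. P w \<and> u = map w [0..<n]}. {w. \<forall>k<n. w k = u ! k})"
  then obtain w' where "P w'" "\<forall>k<n. w k = w' k"
    by auto
  with assms[of w w'] show "w \<in> {w. P w}"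
    by auto
qed

lemma sets_finite_prefix:
  fixes P :: "(nat \<Rightarrow> 'a::countable) \<Rightarrow> bool"
  assumes "\<And>w w'. (\<And>k. k < n \<Longrightarrow> w k = w' k) \<Longrightarrow> P w = P w'"
  shows "{w. P w} \<in> sets word_space"
proof -
  have "(\<Union>u\<in>{u. \<exists>w. P w \<and> u = map w [0..<n]}. {w. \<forall>k<n. w k = u ! k}) \<in> sets word_space"
    using sets_prefix_cylinder by (intro sets.countable_UN') auto
  moreover have "{w. P w} = (\<Union>u\<in>{u. \<exists>w. P w \<and> u = map w [0..<n]}. {w. \<forall>k<n. w k = u ! k})"
    by (rule finite_prefix_eq_UN) (rule assms)
  ultimately show ?thesis
    by (simp only:)
qed

lemma sets_stay: "{w. \<forall>i. w i \<in> S'} \<in> sets (word_space :: (nat \<Rightarrow> 's::countable) measure)"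
proof -
  have "{w. \<forall>i. w i \<in> S'} = (\<Inter>i. {w :: nat \<Rightarrow> 's. w i \<in> S'})"
    by auto
  also have "\<dots> \<in> sets word_space"
    using sets_finite_prefix[of "Suc i" "\<lambda>w. w i \<in> S'" for i] by (intro sets.countable_INT) auto
  finally show ?thesis .
qed

text \<open>Agreement is asked only for prefixes satisfying \<open>P\<close>. This is what lets the
  restricted chain be compared with the original one on prefixes inside \<open>S'\<close>.\<close>

lemma emeasure_eq_finite_prefix:
  fixes P :: "(nat \<Rightarrow> 'a::countable) \<Rightarrow> bool"
  assumes sets: "sets M = sets word_space" "sets N = sets word_space"
    and P: "\<And>w w'. (\<And>k. k < n \<Longrightarrow> w k = w' k) \<Longrightarrow> P w = P w'"
    and eq: "\<And>w. P w \<Longrightarrow> emeasure M {v. \<forall>k<n. v k = w k} = emeasure N {v. \<forall>k<n. v k = w k}"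
  shows "emeasure M {w. P w} = emeasure N {w. P w}"
proof -
  let ?U = "{u. \<exists>w. P w \<and> u = map w [0..<n]}" and ?cyl = "\<lambda>u. {w. \<forall>k<n. w k = u ! k}"
  have disj: "disjoint_family_on ?cyl ?U"
    unfolding disjoint_family_on_def
  proof (intro ballI impI)
    fix u u' assume u: "u \<in> ?U" "u' \<in> ?U" "u \<noteq> u'"
    then have "length u = n" "length u' = n"
      by auto
    with u(3) obtain k where "k < n" "u ! k \<noteq> u' ! k"
      by (metis nth_equalityI)
    then show "?cyl u \<inter> ?cyl u' = {}"
      by auto
  qed
  have "emeasure M (\<Union>u\<in>?U. ?cyl u) = (\<integral>\<^sup>+u. emeasure M (?cyl u) \<partial>count_space ?U)"
    using disj by (intro emeasure_UN_countable) (simp_all add: sets sets_prefix_cylinder)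
  also have "\<dots> = (\<integral>\<^sup>+u. emeasure N (?cyl u) \<partial>count_space ?U)"
  proof (intro nn_integral_cong)
    fix u assume "u \<in> space (count_space ?U)"
    then obtain w where w: "P w" "u = map w [0..<n]"
      by auto
    then have "?cyl u = {v. \<forall>k<n. v k = w k}"
      by auto
    then show "emeasure M (?cyl u) = emeasure N (?cyl u)"
      using eq[OF w(1)] by simp
  qed
  also have "\<dots> = emeasure N (\<Union>u\<in>?U. ?cyl u)"
    using disj by (intro emeasure_UN_countable[symmetric]) (simp_all add: sets sets_prefix_cylinder)
  moreover have "{w. P w} = (\<Union>u\<in>?U. ?cyl u)"
    by (rule finite_prefix_eq_UN) (rule P)
  ultimately show ?thesis
    by (simp only:)
qed

text \<open>A condition on the coordinates in \<open>J\<close> is decided by the first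
  \<open>Suc (Max J)\<close> letters, so prefixes can replace general finite-dimensional
  rectangles.\<close>

lemma measure_eqI_prefix_cylinders:
  fixes M :: "(nat \<Rightarrow> 'a::countable) measure"
  assumes sets: "sets M = sets word_space" "sets N = sets word_space" and fin: "finite_measure M"
    and eq: "\<And>n w. emeasure M {v. \<forall>k<n. v k = w k} = emeasure N {v. \<forall>k<n. v k = w k}"
  shows "M = N"
proof (rule measure_eqI_PiM_infinite[OF sets _ fin])
  fix A :: "nat \<Rightarrow> 'a set" and J :: "nat set" assume J: "finite J"
  have "prod_emb UNIV (\<lambda>_. count_space UNIV) J (Pi\<^sub>E J A) = {w. \<forall>j\<in>J. w j \<in> A j}"
    by (auto simp: prod_emb_def PiE_iff)
  moreover have "emeasure M {w. \<forall>j\<in>J. w j \<in> A j} = emeasure N {w. \<forall>j\<in>J. w j \<in> A j}"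
  proof (rule emeasure_eq_finite_prefix[OF sets _ eq])
    fix w w' :: "nat \<Rightarrow> 'a" assume "\<And>k. k < Suc (Max J) \<Longrightarrow> w k = w' k"
    then have "w j = w' j" if "j \<in> J" for j
      using J that by (simp add: le_imp_less_Suc)
    then show "(\<forall>j\<in>J. w j \<in> A j) = (\<forall>j\<in>J. w' j \<in> A j)"
      by simp
  qed
  ultimately show "emeasure M (prod_emb UNIV (\<lambda>_. count_space UNIV) J (Pi\<^sub>E J A)) =
      emeasure N (prod_emb UNIV (\<lambda>_. count_space UNIV) J (Pi\<^sub>E J A))"
    by simp
qed

text \<open>
  The flag \<open>b = False\<close> imposes no condition, and position \<open>j\<close> is excluded from the accepting visits, so
  that profiles of consecutive factors compose.
\<close>

definition profile :: "('q, 's) buchi \<Rightarrow> (nat \<Rightarrow> 's) \<Rightarrow> nat \<Rightarrow> nat \<Rightarrow> ('q \<times> 'q \<times> bool) set" where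
  "profile A w i j = {(p, q, b). \<exists>r. r i = p \<and> r j = q \<and>
     (\<forall>k\<in>{i..<j}. r (Suc k) \<in> buchi_delta A (r k) (w k)) \<and>
     (b \<longrightarrow> (\<exists>k\<in>{i..<j}. r k \<in> buchi_acc A))}"

lemma profile_append:
  assumes "i \<le> j" "j \<le> k"
  shows "(p, q, b) \<in> profile A w i k \<longleftrightarrow>
    (\<exists>m c d. (p, m, c) \<in> profile A w i j \<and> (m, q, d) \<in> profile A w j k \<and> (b \<longrightarrow> c \<or> d))"
proof
  assume "(p, q, b) \<in> profile A w i k"
  then have "\<exists>r. r i = p \<and> r k = q \<and> (\<forall>l\<in>{i..<k}. r (Suc l) \<in> buchi_delta A (r l) (w l)) \<and>
      (b \<longrightarrow> (\<exists>l\<in>{i..<k}. r l \<in> buchi_acc A))"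
    by (simp add: profile_def)
  then obtain r where r: "r i = p" "r k = q" "\<forall>l\<in>{i..<k}. r (Suc l) \<in> buchi_delta A (r l) (w l)"
    and acc: "b \<longrightarrow> (\<exists>l\<in>{i..<k}. r l \<in> buchi_acc A)"
    by blast
  have "(p, r j, \<exists>l\<in>{i..<j}. r l \<in> buchi_acc A) \<in> profile A w i j"
    using r assms unfolding profile_def by (auto intro!: exI[of _ r])
  moreover have "(r j, q, \<exists>l\<in>{j..<k}. r l \<in> buchi_acc A) \<in> profile A w j k"
    using r assms unfolding profile_def by (auto intro!: exI[of _ r])
  moreover have "b \<longrightarrow> (\<exists>l\<in>{i..<j}. r l \<in> buchi_acc A) \<or> (\<exists>l\<in>{j..<k}. r l \<in> buchi_acc A)"
    using acc by (metis atLeastLessThan_iff linorder_not_less)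
  ultimately show "\<exists>m c d. (p, m, c) \<in> profile A w i j \<and> (m, q, d) \<in> profile A w j k \<and> (b \<longrightarrow> c \<or> d)"
    by (intro exI conjI)
next
  assume "\<exists>m c d. (p, m, c) \<in> profile A w i j \<and> (m, q, d) \<in> profile A w j k \<and> (b \<longrightarrow> c \<or> d)"
  then obtain m c d where bcd: "b \<longrightarrow> c \<or> d"
    and prof: "(p, m, c) \<in> profile A w i j" "(m, q, d) \<in> profile A w j k"
    by blast
  from prof(1) obtain r where r: "r i = p" "r j = m" "\<forall>l\<in>{i..<j}. r (Suc l) \<in> buchi_delta A (r l) (w l)"
      "c \<longrightarrow> (\<exists>l\<in>{i..<j}. r l \<in> buchi_acc A)"
    unfolding profile_def by blast
  from prof(2) obtain r' where r': "r' j = m" "r' k = q" "\<forall>l\<in>{j..<k}. r' (Suc l) \<in> buchi_delta A (r' l) (w l)"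
      "d \<longrightarrow> (\<exists>l\<in>{j..<k}. r' l \<in> buchi_acc A)"
    unfolding profile_def by blast
  define f where "f l = (if l < j then r l else r' l)" for l
  have "f i = p" "f k = q"
    using assms r r' by (auto simp: f_def)
  moreover have "f (Suc l) \<in> buchi_delta A (f l) (w l)" if "l \<in> {i..<k}" for l
  \<comment> \<open>At the seam \<open>f\<close> switches to \<open>r'\<close>, but
    \<open>r' j = m = r j\<close>, so the last transition of \<open>r\<close> still fits.\<close>
  proof (cases "Suc l = j")
    case True
    then have "l \<in> {i..<j}" "f (Suc l) = r (Suc l)" "f l = r l"
      using that r r' by (auto simp: f_def)
    then show ?thesis
      using r(3) by auto
  next
    case False
    then show ?thesis
      using that r(3) r'(3) by (auto simp: f_def)
  qed
  moreover have "\<exists>l\<in>{i..<k}. f l \<in> buchi_acc A" if b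
  proof (cases c)
    case True
    with r(4) obtain l where "l \<in> {i..<j}" "r l \<in> buchi_acc A"
      by blast
    then show ?thesis
      using assms by (intro bexI[of _ l]) (auto simp: f_def)
  next
    case False
    with bcd r'(4) that obtain l where "l \<in> {j..<k}" "r' l \<in> buchi_acc A"
      by blast
    then show ?thesis
      using assms by (intro bexI[of _ l]) (auto simp: f_def)
  qed
  ultimately show "(p, q, b) \<in> profile A w i k"
    unfolding profile_def by auto
qed

lemma profile_append_cong:
  assumes "profile A w i k = profile A w j k" "i \<le> k" "j \<le> k" "k \<le> l"
  shows "profile A w i l = profile A w j l"
  using profile_append[OF assms(2,4), of _ _ _ A w] profile_append[OF assms(3,4), of _ _ _ A w] assms(1)
  by auto

lemma profile_cong:
  assumes "\<And>k. k < j \<Longrightarrow> w k = w' k"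
  shows "profile A w i j = profile A w' i j"
  using assms by (auto simp: profile_def)

text \<open>The blocks are finite and, by \<open>g 0 = 0\<close>, cover all positions; so infinitely
  many accepting visits meet infinitely many blocks.\<close>

lemma accepting_run_profile:
  assumes run: "accepting_run A q w r" and g: "strict_mono g" "g 0 = 0"
  obtains b where "\<And>m. (r (g m), r (g (Suc m)), b m) \<in> profile A w (g m) (g (Suc m))" "\<exists>\<^sub>\<infinity>m. b m"
proof
  define b where "b m \<longleftrightarrow> (\<exists>k\<in>{g m..<g (Suc m)}. r k \<in> buchi_acc A)" for m
  show "(r (g m), r (g (Suc m)), b m) \<in> profile A w (g m) (g (Suc m))" for m
    using run unfolding profile_def b_def accepting_run_def by blast
  show "\<exists>\<^sub>\<infinity>m. b m"
    unfolding INFM_nat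
  proof
    fix n
    obtain k where k: "g (Suc n) < k" "r k \<in> buchi_acc A"
      using run unfolding accepting_run_def INFM_nat by blast
    \<comment> \<open>The block containing \<open>k\<close>. It comes after block \<open>n\<close>
      because \<open>k\<close> lies beyond the start of block \<open>Suc n\<close>.\<close>
    define m where "m = (LEAST m. k < g (Suc m))"
    have "k < g (Suc k)"
      using strict_mono_imp_increasing[OF g(1), of "Suc k"] by simp
    then have m: "k < g (Suc m)"
      unfolding m_def by (rule LeastI)
    have "n < m"
      using m k(1) strict_mono_less[OF g(1)] by (metis less_trans not_less_eq Suc_less_eq)
    then obtain m' where m': "m = Suc m'"
      by (cases m) auto
    then have "\<not> k < g (Suc m')"
      using not_less_Least[of m' "\<lambda>m. k < g (Suc m)"] by (simp add: m_def)
    with m m' k have "b m"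
      by (auto simp: b_def)
    with \<open>n < m\<close> show "\<exists>m>n. b m"
      by blast
  qed
qed

text \<open>Local runs witnessing the profiles are glued together; neighbours agree at their common
  border, where both take the value \<open>f (Suc m)\<close>.\<close>

lemma accepting_run_of_profiles:
  assumes g: "strict_mono g" "g 0 = (0 :: nat)"
    and prof: "\<And>m. (f m, f (Suc m), b m) \<in> profile A w (g m) (g (Suc m))" and inf: "\<exists>\<^sub>\<infinity>m. b m"
  shows "w \<in> language A (f 0)"
proof -
  have "\<forall>m. \<exists>r. r (g m) = f m \<and> r (g (Suc m)) = f (Suc m) \<and>
     (\<forall>k\<in>{g m..<g (Suc m)}. r (Suc k) \<in> buchi_delta A (r k) (w k)) \<and>
     (b m \<longrightarrow> (\<exists>k\<in>{g m..<g (Suc m)}. r k \<in> buchi_acc A))"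
    using prof unfolding profile_def by auto
  then obtain R where R: "\<And>m. R m (g m) = f m" "\<And>m. R m (g (Suc m)) = f (Suc m)"
     "\<And>m k. k \<in> {g m..<g (Suc m)} \<Longrightarrow> R m (Suc k) \<in> buchi_delta A (R m k) (w k)"
     "\<And>m. b m \<Longrightarrow> \<exists>k\<in>{g m..<g (Suc m)}. R m k \<in> buchi_acc A"
    by metis
  define blk where "blk k = (LEAST m. k < g (Suc m))" for k
  have blk: "blk k = m" if "k \<in> {g m..<g (Suc m)}" for k m
    unfolding blk_def
  proof (rule Least_equality)
    fix m' assume "k < g (Suc m')"
    then have "g m < g (Suc m')"
      using that by auto
    then show "m \<le> m'"
      using strict_mono_less[OF g(1)] by (simp add: less_Suc_eq_le)
  qed (use that in simp)
  have in_blk: "k \<in> {g (blk k)..<g (Suc (blk k))}" for k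
  proof -
    have "k < g (Suc k)"
      using strict_mono_imp_increasing[OF g(1), of "Suc k"] by simp
    then have less: "k < g (Suc (blk k))"
      unfolding blk_def by (rule LeastI)
    have "g (blk k) \<le> k"
    proof (cases "blk k")
      case (Suc m)
      then have "\<not> k < g (Suc m)"
        using not_less_Least[of m "\<lambda>m. k < g (Suc m)"] by (simp add: blk_def)
      with Suc show ?thesis by simp
    qed (simp add: g)
    with less show ?thesis by simp
  qed
  define r where "r k = R (blk k) k" for k
  have r: "r k = R m k" if "k \<in> {g m..<g (Suc m)}" for k m
    using blk[OF that] by (simp add: r_def)
  have r_end: "r (Suc k) = R m (Suc k)" if "k \<in> {g m..<g (Suc m)}" for k m
  proof (cases "Suc k < g (Suc m)")
    case True
    then show ?thesis
      using that by (intro r) auto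
  next
    case False
    then have "Suc k = g (Suc m)"
      using that by auto
    moreover have "g (Suc m) < g (Suc (Suc m))"
      using strict_mono_less[OF g(1)] by simp
    ultimately have "r (Suc k) = R (Suc m) (Suc k)"
      by (intro r) auto
    then show ?thesis
      using \<open>Suc k = g (Suc m)\<close> R(1,2) by simp
  qed
  have "r 0 = f 0"
    using r[of 0 0] R(1)[of 0] g strict_mono_less[OF g(1), of 0 1] by simp
  moreover have "r (Suc k) \<in> buchi_delta A (r k) (w k)" for k
    using R(3)[OF in_blk] r_end[OF in_blk] r[OF in_blk] by metis
  moreover have "\<exists>\<^sub>\<infinity>k. r k \<in> buchi_acc A"
    unfolding INFM_nat
  proof
    fix n
    obtain m where m: "n < m" "b m"
      using inf unfolding INFM_nat by blast
    from R(4)[OF m(2)] obtain k where k: "k \<in> {g m..<g (Suc m)}" "R m k \<in> buchi_acc A"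
      by blast
    have "n < k"
      using strict_mono_imp_increasing[OF g(1), of m] m(1) k(1) by auto
    with k r[OF k(1)] show "\<exists>k>n. r k \<in> buchi_acc A"
      by metis
  qed
  ultimately show ?thesis
    unfolding language_def accepting_run_def by blast
qed

text \<open>
  Positions \<open>i\<close> and \<open>j\<close> merge at \<open>k\<close> if the profiles of \<open>w i \<dots> w (k - 1)\<close> and \<open>w j \<dots> w (k - 1)\<close> coincide; they
  then coincide for all later \<open>k\<close>. Infinitely many positions merging with \<open>i\<close> at profile \<open>e\<close> can
  therefore be thinned out to a factorization of the word with profiles \<open>s, e, e, \<dots>\<close>. Unlike the
  existence of such a factorization, the merging condition only quantifies over positions.
\<close>

definition ramsey_type ::
  "('q, 's) buchi \<Rightarrow> ('q \<times> 'q \<times> bool) set \<Rightarrow> ('q \<times> 'q \<times> bool) set \<Rightarrow> (nat \<Rightarrow> 's) \<Rightarrow> bool" where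
  "ramsey_type A s e w \<longleftrightarrow> (\<exists>i>0. profile A w 0 i = s \<and>
     (\<forall>n. \<exists>j>n. i < j \<and> profile A w i j = e \<and> (\<exists>k\<ge>j. profile A w i k = profile A w j k)))"

text \<open>There are finitely many profiles, so Ramsey's theorem for pairs of positions gives an
  infinite \<open>Y\<close> between whose members all factors have one profile. Two members of
  \<open>Y\<close> then merge at any later member, since both factors ending there have this
  profile.\<close>

lemma ramsey_type_exists:
  fixes A :: "('q::finite, 's) buchi"
  obtains s e where "ramsey_type A s e w"
proof -
  define col where "col X = to_nat (profile A w (Min X) (Max X))" for X :: "nat set"
  define N where "N = Suc (Max (range (to_nat :: ('q \<times> 'q \<times> bool) set \<Rightarrow> nat)))"
  have "col X < N" for X
    by (simp add: col_def N_def less_Suc_eq_le)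
  \<comment> \<open>Position 0 is excluded so that the first factor is nonempty, as strictly
    increasing cut points starting at 0 require.\<close>
  then obtain Y t where Y: "infinite Y" "\<And>x y. x \<in> Y \<Longrightarrow> y \<in> Y \<Longrightarrow> x \<noteq> y \<Longrightarrow> col {x, y} = t" and pos: "Y \<subseteq> {0<..}"
    using Ramsey2[of "{0<..} :: nat set" col N] by (auto simp: infinite_Ioi)
  have t: "to_nat (profile A w x y) = t" if "x \<in> Y" "y \<in> Y" "x < y" for x y
    using Y(2)[OF that(1,2)] that(3) by (simp add: col_def)
  obtain i where i: "i \<in> Y"
    using infinite_imp_nonempty[OF Y(1)] by blast
  obtain j\<^sub>0 where j\<^sub>0: "j\<^sub>0 \<in> Y" "i < j\<^sub>0"
    using Y(1) by (auto simp: infinite_nat_iff_unbounded)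
  have eq: "profile A w x y = profile A w i j\<^sub>0" if "x \<in> Y" "y \<in> Y" "x < y" for x y
    using t[OF that] t[OF i j\<^sub>0] by (metis inj_to_nat injD)
  have "ramsey_type A (profile A w 0 i) (profile A w i j\<^sub>0) w"
    unfolding ramsey_type_def
  proof (rule exI[of _ i], intro conjI allI refl)
    fix n
    obtain j where j: "j \<in> Y" "max n i < j"
      using Y(1) unfolding infinite_nat_iff_unbounded by blast
    obtain k where k: "k \<in> Y" "j < k"
      using Y(1) by (auto simp: infinite_nat_iff_unbounded)
    show "\<exists>j>n. i < j \<and> profile A w i j = profile A w i j\<^sub>0 \<and> (\<exists>k\<ge>j. profile A w i k = profile A w j k)"
      using i j k by (intro exI[of _ j] conjI exI[of _ k]) (simp_all add: eq)
  qed (use i pos in auto)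
  then show ?thesis
    by (rule that)
qed

text \<open>Every cut point merges with \<open>i\<close>. Beyond the place where \<open>j\<close>
  merges with \<open>i\<close>, factors starting at \<open>j\<close> and at \<open>i\<close> have
  equal profiles, so a later \<open>j'\<close> with profile \<open>e\<close> from \<open>i\<close>
  also has profile \<open>e\<close> from \<open>j\<close>.\<close>

lemma ramsey_type_factorization:
  assumes "ramsey_type A s e w"
  obtains g where "strict_mono g" "g 0 = 0" "\<And>m. profile A w (g m) (g (Suc m)) = (if m = 0 then s else e)"
proof -
  obtain i where i: "0 < i" "profile A w 0 i = s"
    and inf: "\<And>n. \<exists>j>n. i < j \<and> profile A w i j = e \<and> (\<exists>k\<ge>j. profile A w i k = profile A w j k)"
    using assms by (auto simp: ramsey_type_def)
  define P where "P j \<longleftrightarrow> i \<le> j \<and> (\<exists>k\<ge>j. profile A w i k = profile A w j k)" for j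
  have step: "\<exists>j'. P j' \<and> j < j' \<and> profile A w j j' = e" if j: "P j" for j
  proof -
    obtain k where k: "j \<le> k" "profile A w i k = profile A w j k" "i \<le> j"
      using j by (auto simp: P_def)
    obtain j' where j': "k < j'" "i < j'" "profile A w i j' = e" "\<exists>k\<ge>j'. profile A w i k = profile A w j' k"
      using inf by blast
    have "profile A w j j' = e"
      using profile_append_cong[OF k(2), of j'] k j' by simp
    then show ?thesis
      using j' k(1) by (intro exI[of _ j']) (auto simp: P_def)
  qed
  have "\<exists>h. h 0 = i \<and> (\<forall>m. P (h m)) \<and> (\<forall>m. h m < h (Suc m) \<and> profile A w (h m) (h (Suc m)) = e)"
  proof (rule dependent_nat_choice[where P = "\<lambda>m j. (m = 0 \<longrightarrow> j = i) \<and> P j"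
        and Q = "\<lambda>m j j'. j < j' \<and> profile A w j j' = e", THEN exE])
    show "\<exists>j. (0 = 0 \<longrightarrow> j = i) \<and> P j"
      by (auto simp: P_def)
  qed (use step in \<open>auto\<close>)
  then obtain h where h: "h 0 = i" "\<And>m. h m < h (Suc m)" "\<And>m. profile A w (h m) (h (Suc m)) = e"
    by blast
  show ?thesis
  proof
    show "strict_mono (case_nat 0 h)"
      using i h by (intro strict_mono_Suc_iff[THEN iffD2]) (auto split: nat.split)
    show "profile A w (case_nat 0 h m) (case_nat 0 h (Suc m)) = (if m = 0 then s else e)" for m
      using i h by (cases m) auto
  qed simp
qed

text \<open>Of an accepting run only the states at the cut points and one acceptance flag per block
  matter; equal profiles permit the same states and flags on \<open>w'\<close>.\<close>

lemma language_ramsey_type: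
  assumes "ramsey_type A s e w" "ramsey_type A s e w'" "w \<in> language A q"
  shows "w' \<in> language A q"
proof -
  obtain g where g: "strict_mono g" "g 0 = 0" "\<And>m. profile A w (g m) (g (Suc m)) = (if m = 0 then s else e)"
    using ramsey_type_factorization[OF assms(1)] by blast
  obtain g' where g': "strict_mono g'" "g' 0 = 0" "\<And>m. profile A w' (g' m) (g' (Suc m)) = (if m = 0 then s else e)"
    using ramsey_type_factorization[OF assms(2)] by blast
  obtain r where r: "accepting_run A q w r"
    using assms(3) by (auto simp: language_def)
  obtain b where b: "\<And>m. (r (g m), r (g (Suc m)), b m) \<in> profile A w (g m) (g (Suc m))" "\<exists>\<^sub>\<infinity>m. b m"
    using accepting_run_profile[OF r g(1,2)] by blast
  have "w' \<in> language A (r (g 0))"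
    using b by (intro accepting_run_of_profiles[OF g'(1,2), where b = b]) (simp_all add: g(3) g'(3))
  moreover have "r (g 0) = q"
    using r g(2) by (simp add: accepting_run_def)
  ultimately show ?thesis by simp
qed

lemma sets_ramsey_type:
  fixes A :: "('q, 's::countable) buchi"
  shows "{w. ramsey_type A s e w} \<in> sets word_space"
proof -
  have prof: "Measurable.pred word_space (\<lambda>w. profile A w i j = t)" for i j t
  proof -
    have "{w. profile A w i j = t} \<in> sets word_space"
      by (rule sets_finite_prefix[of j]) (metis profile_cong)
    then show ?thesis
      by (simp add: pred_def space_word_space)
  qed
  have merge: "Measurable.pred word_space (\<lambda>w. profile A w i k = profile A w j k)" for i j k
  proof -
    have "{w. profile A w i k = profile A w j k} \<in> sets word_space"
      by (rule sets_finite_prefix[of k]) (metis profile_cong)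
    then show ?thesis
      by (simp add: pred_def space_word_space)
  qed
  have "Measurable.pred word_space (ramsey_type A s e)"
    unfolding ramsey_type_def[abs_def]
    by (intro pred_intros_countable pred_intros_logic prof merge) auto
  then show ?thesis
    by (simp add: pred_def space_word_space)
qed

text \<open>A type class lies inside the language or is disjoint from it, so the union over
  uncountably many runs becomes a finite union of measurable classes.\<close>

lemma sets_language:
  fixes A :: "('q::finite, 's::countable) buchi"
  shows "language A q \<in> sets word_space"
proof -
  let ?T = "{(s, e). \<exists>w\<in>language A q. ramsey_type A s e w}"
  have "language A q = (\<Union>(s, e)\<in>?T. {w. ramsey_type A s e w})"
  proof (intro Set.set_eqI iffI)
    fix w assume w: "w \<in> language A q"
    obtain s e where "ramsey_type A s e w"
      by (rule ramsey_type_exists)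
    with w show "w \<in> (\<Union>(s, e)\<in>?T. {w. ramsey_type A s e w})"
      by auto
  qed (auto intro: language_ramsey_type)
  also have "\<dots> \<in> sets word_space"
    by (rule sets.finite_UN) (auto intro: sets_ramsey_type finite_subset[OF subset_UNIV])
  finally show ?thesis .
qed

section \<open>The path measure\<close>

lemma singleton_restrict_eq_PiE: "{restrict a I} = Pi\<^sub>E I (\<lambda>i. {a i})"
proof -
  have "Pi\<^sub>E I (\<lambda>i. {a i}) = Pi\<^sub>E I (\<lambda>i. {restrict a I i})"
    by (rule PiE_cong) simp
  then show ?thesis
    by (simp add: PiE_singleton del: restrict_apply)
qed

text \<open>Chain rule, one kernel at a time. Finite trajectories are extensional functions, hence a
  single restricted function instead of a cylinder.\<close>

lemma emeasure_path_kernel_prefix: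
  fixes C :: "'s::finite dtmc" and a :: "nat \<Rightarrow> 's option"
  shows "emeasure (Ionescu_Tulcea.C (path_kernel C s) (\<lambda>_. count_space UNIV) 0 n (\<lambda>_. undefined))
    {restrict a {0..<n}} = (\<Prod>i<n. emeasure (path_kernel C s i a) {a i})"
proof -
  interpret IT: Ionescu_Tulcea "path_kernel C s" "\<lambda>_. count_space UNIV"
    by (rule Ionescu_Tulcea_path_kernel)
  have undef: "(\<lambda>_. undefined) \<in> space (PiM {0..<0::nat} (\<lambda>_. count_space (UNIV :: 's option set)))"
    by (simp add: space_PiM)
  have meas: "{restrict a {0..<n}} \<in> sets (PiM {0..<n} (\<lambda>_. count_space UNIV))" for n
  proof -
    have "{restrict a {0..<n}} = Pi\<^sub>E {0..<n} (\<lambda>i. {a i})"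
      by (rule singleton_restrict_eq_PiE)
    also have "\<dots> \<in> sets (PiM {0..<n} (\<lambda>_. count_space UNIV))"
      by (intro sets_PiM_I_finite) auto
    finally show ?thesis .
  qed
  show ?thesis
  proof (induction n)
    case 0
    have "(\<lambda>_. undefined) = restrict a {0..<0}"
      by auto
    then show ?case
      using meas[of 0] by (simp add: emeasure_return)
  next
    case (Suc n)
    let ?C = "IT.C 0 n (\<lambda>_. undefined)" and ?A = "{restrict a {0..<Suc n}}"
    have eP: "emeasure (IT.eP n \<omega>) ?A =
        emeasure (path_kernel C s n a) {a n} * indicator {restrict a {0..<n}} \<omega>"
      if "\<omega> \<in> space ?C" for \<omega>
    proof -
      have \<omega>: "\<omega> \<in> space (PiM {0..<n} (\<lambda>_. count_space (UNIV :: 's option set)))"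
        using that IT.space_C[OF undef] by simp
      then have ext: "\<omega> \<in> extensional {0..<n}"
        by (simp add: space_PiM PiE_iff)
      \<comment> \<open>The kernel at time \<open>n\<close> reads at most the state at time
        \<open>n - 1\<close>, which the restriction keeps.\<close>
      have kern: "path_kernel C s n \<omega> = path_kernel C s n a" if "\<omega> = restrict a {0..<n}"
        using that by (auto simp: path_kernel_def split: nat.split)
      have "(\<lambda>x. fun_upd \<omega> n x) -` ?A = (if \<omega> = restrict a {0..<n} then {a n} else {})"
      proof (intro Set.set_eqI)
        fix x
        have "fun_upd \<omega> n x = restrict a {0..<Suc n} \<longleftrightarrow> x = a n \<and> \<omega> = restrict a {0..<n}"
        proof
          assume eq: "fun_upd \<omega> n x = restrict a {0..<Suc n}"
          have "\<omega> i = restrict a {0..<n} i" for i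
          proof (cases "i < n")
            case True
            then show ?thesis
              using fun_cong[OF eq, of i] by simp
          next
            case False
            then show ?thesis
              using ext by (simp add: extensional_def)
          qed
          moreover have "x = a n"
            using fun_cong[OF eq, of n] by simp
          ultimately show "x = a n \<and> \<omega> = restrict a {0..<n}"
            by auto
        qed (auto simp: fun_eq_iff restrict_def)
        then show "x \<in> (\<lambda>x. fun_upd \<omega> n x) -` ?A \<longleftrightarrow> x \<in> (if \<omega> = restrict a {0..<n} then {a n} else {})"
          by simp
      qed
      then show ?thesis
        using kern by (simp add: IT.emeasure_eP[OF \<omega> meas] split: split_indicator)
    qed
    have "emeasure (IT.C 0 (Suc n) (\<lambda>_. undefined)) ?A = (\<integral>\<^sup>+\<omega>. emeasure (IT.eP n \<omega>) ?A \<partial>?C)"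
      using IT.measurable_eP[of n] prob_space.not_empty[OF IT.prob_space_C[OF undef, of n]] meas
      by (simp add: emeasure_bind[where N = "PiM {0..<Suc n} (\<lambda>_. count_space UNIV)"]
          measurable_cong_sets[OF IT.sets_C[OF undef] refl])
    also have "\<dots> = (\<integral>\<^sup>+\<omega>. emeasure (path_kernel C s n a) {a n} * indicator {restrict a {0..<n}} \<omega> \<partial>?C)"
      by (intro nn_integral_cong eP)
    also have "\<dots> = emeasure (path_kernel C s n a) {a n} * emeasure ?C {restrict a {0..<n}}"
      using meas by (intro nn_integral_cmult_indicator) (simp add: IT.sets_C[OF undef])
    finally show ?case
      unfolding Suc.IH prod.lessThan_Suc by (simp only: mult.commute)
  qed
qed

lemma sets_path_measure: "sets (path_measure C s) = sets word_space"
proof -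
  interpret IT: Ionescu_Tulcea "path_kernel C s" "\<lambda>_. count_space UNIV"
    by (rule Ionescu_Tulcea_path_kernel)
  show ?thesis
    by (simp add: path_measure_def)
qed

lemma space_path_measure: "space (path_measure C s) = UNIV"
  using sets_eq_imp_space_eq[OF sets_path_measure] by (simp add: space_word_space)

lemma emeasure_path_measure_prefix:
  "emeasure (path_measure C s) {\<omega>. \<forall>i<n. \<omega> i = a i} = (\<Prod>i<n. emeasure (path_kernel C s i a) {a i})"
proof -
  interpret IT: Ionescu_Tulcea "path_kernel C s" "\<lambda>_. count_space UNIV"
    by (rule Ionescu_Tulcea_path_kernel)
  let ?X = "{restrict a {0..<n}}"
  have sing: "?X = Pi\<^sub>E {0..<n} (\<lambda>i. {a i})"
    by (rule singleton_restrict_eq_PiE)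
  have X: "?X \<in> sets (PiM {0..<n} (\<lambda>_. count_space UNIV))"
    unfolding sing by (intro sets_PiM_I_finite) auto
  have "{\<omega>. \<forall>i<n. \<omega> i = a i} = prod_emb UNIV (\<lambda>_. count_space UNIV) {0..<n} ?X"
    unfolding sing by (auto simp: prod_emb_def PiE_iff)
  then have "emeasure (path_measure C s) {\<omega>. \<forall>i<n. \<omega> i = a i} = emeasure (IT.CI {0..<n}) ?X"
    unfolding path_measure_def using IT.lim[OF _ X] by simp
  also have "\<dots> = emeasure (IT.C 0 n (\<lambda>_. undefined)) ?X"
    using IT.emeasure_CI[OF subset_refl X] sets.sets_into_space[OF X] by (simp add: prod_emb_id space_PiM)
  finally show ?thesis
    by (simp add: emeasure_path_kernel_prefix)
qed

lemma prob_space_path_measure: "prob_space (path_measure C s)"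
  using emeasure_path_measure_prefix[of C s 0 "\<lambda>_. None"]
  by (intro prob_spaceI) (simp add: space_path_measure)

text \<open>\<open>path_measure\<close> starts only in genuine states, while a step of the completed
  chain may lead to \<open>None\<close>. With the constant trajectory as the law from there, the
  family is closed under steps.\<close>

definition chain_measure :: "'s::finite dtmc \<Rightarrow> 's option \<Rightarrow> (nat \<Rightarrow> 's option) measure" where
  "chain_measure C x = (case x of Some s \<Rightarrow> path_measure C s | None \<Rightarrow> return word_space (\<lambda>_. None))"

lemma sets_chain_measure: "sets (chain_measure C x) = sets word_space"
  by (simp add: chain_measure_def sets_path_measure split: option.split)

lemma space_chain_measure: "space (chain_measure C x) = UNIV"
  by (simp add: chain_measure_def space_path_measure space_word_space split: option.split)

lemma prob_space_chain_measure: "prob_space (chain_measure C x)"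
  by (auto simp: chain_measure_def prob_space_path_measure space_word_space
      intro!: prob_space_return split: option.split)

lemma emeasure_chain_measure_prefix:
  "emeasure (chain_measure C x) {\<omega>. \<forall>i<Suc n. \<omega> i = a i} =
    indicator {x} (a 0) * (\<Prod>i<n. ennreal (pmf (step_pmf C (a i)) (a (Suc i))))"
proof (cases x)
  case (Some s)
  have "emeasure (path_kernel C s 0 a) {a 0} = indicator {x} (a 0)"
    using Some by (auto simp: path_kernel_def indicator_def)
  moreover have "emeasure (path_kernel C s (Suc i) a) {a (Suc i)} = ennreal (pmf (step_pmf C (a i)) (a (Suc i)))" for i
    by (simp add: path_kernel_def emeasure_pmf_single)
  ultimately show ?thesis
    unfolding chain_measure_def
    by (simp add: Some emeasure_path_measure_prefix prod.lessThan_Suc_shift del: prod.lessThan_Suc)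
next
  case None
  have "emeasure (chain_measure C x) {\<omega>. \<forall>i<Suc n. \<omega> i = a i} = indicator {\<omega>. \<forall>i<Suc n. \<omega> i = a i} (\<lambda>_. None)"
    unfolding chain_measure_def using sets_prefix_cylinder[of "Suc n" a] by (simp add: None)
  also have "\<dots> = indicator {x} (a 0) * (\<Prod>i<n. ennreal (pmf (step_pmf C (a i)) (a (Suc i))))"
  proof (cases "\<forall>i<Suc n. a i = None")
    case True
    then show ?thesis
      by (simp add: None step_pmf_def)
  next
    case False
    \<comment> \<open>The first exit of the prefix from \<open>None\<close>. If it is at position 0
      the indicator vanishes; otherwise the step into it has probability 0.\<close>
    define m where "m = (LEAST i. a i \<noteq> None)"
    obtain i where i: "i < Suc n" "a i \<noteq> None"
      using False by blast
    then have m: "a m \<noteq> None" "m \<le> i"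
      unfolding m_def by (auto intro: LeastI Least_le)
    have zero: "indicator {\<omega>. \<forall>i<Suc n. \<omega> i = a i} (\<lambda>_. None) = (0 :: ennreal)"
      using False by (auto simp: indicator_def)
    show ?thesis
    proof (cases m)
      case 0
      with m zero show ?thesis
        by (simp add: None)
    next
      case (Suc l)
      then have "a l = None"
        using not_less_Least[of l "\<lambda>i. a i \<noteq> None"] by (auto simp: m_def)
      then have "pmf (step_pmf C (a l)) (a (Suc l)) = 0"
        using m Suc by (auto simp: step_pmf_def pmf_return indicator_def)
      moreover have "l < n"
        using Suc m i by simp
      ultimately have "(\<Prod>i<n. ennreal (pmf (step_pmf C (a i)) (a (Suc i)))) = 0"
        by (intro prod_zero) (auto intro!: bexI[of _ l])
      with zero show ?thesis
        by simp
    qed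
  qed
  finally show ?thesis .
qed

lemma measurable_case_nat_word_space: "case_nat x \<in> measurable word_space word_space"
proof (rule measurable_PiM_single')
  show "(\<lambda>\<omega>. case_nat x \<omega> i) \<in> measurable word_space (count_space UNIV)" for i
    by (cases i) simp_all
qed (simp add: space_PiM)

lemma chain_measure_kernel:
  "(\<lambda>y. distr (chain_measure C y) word_space (case_nat x)) \<in>
    measurable (measure_pmf p) (subprob_algebra word_space)"
proof -
  have "prob_space (distr (chain_measure C y) word_space (case_nat x))" for y
    by (intro prob_space.prob_space_distr prob_space_chain_measure)
      (simp add: measurable_cong_sets[OF sets_chain_measure refl] measurable_case_nat_word_space)
  then show ?thesis
    by (simp add: space_subprob_algebra prob_space_imp_subprob_space)
qed

text \<open>The Markov property at the first step, checked on cylinders. Removing the first letter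
  shortens a prefix by one and the product formula needs at least one letter, so lengths 0 and 1 are
  separate cases.\<close>

lemma chain_measure_first_step:
  "chain_measure C x = measure_pmf (step_pmf C x) \<bind> (\<lambda>y. distr (chain_measure C y) word_space (case_nat x))"
    (is "_ = ?Q")
proof (rule measure_eqI_prefix_cylinders)
  show setsQ: "sets ?Q = sets word_space"
    by (rule sets_bind[where N = word_space]) simp_all
  show "finite_measure (chain_measure C x)"
    by (simp add: prob_space_chain_measure prob_space.finite_measure)
  fix n and a :: "nat \<Rightarrow> 'a option"
  have Q: "emeasure ?Q {v. \<forall>k<n. v k = a k} =
    (\<integral>\<^sup>+y. emeasure (chain_measure C y) {v. \<forall>k<n. case_nat x v k = a k} \<partial>step_pmf C x)"
    using sets_prefix_cylinder[of n a] measurable_case_nat_word_space[of x]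
    by (simp add: emeasure_bind[OF _ chain_measure_kernel] emeasure_distr space_chain_measure
        measurable_cong_sets[OF sets_chain_measure refl] vimage_def)
  have one: "emeasure (chain_measure C y) UNIV = 1" for y
    using prob_space.emeasure_space_1[OF prob_space_chain_measure, of C y] by (simp add: space_chain_measure)
  show "emeasure (chain_measure C x) {v. \<forall>k<n. v k = a k} = emeasure ?Q {v. \<forall>k<n. v k = a k}"
  proof (cases n)
    case 0
    then show ?thesis
      unfolding Q by (simp add: one)
  next
    case (Suc m)
    have shift: "{v. \<forall>k<n. case_nat x v k = a k} = (if a 0 = x then {v. \<forall>k<m. v k = a (Suc k)} else {})"
      unfolding Suc by (auto simp: All_less_Suc2)
    show ?thesis
    proof (cases m)
      case 0
      then show ?thesis
        unfolding Q shift using Suc emeasure_chain_measure_prefix[of C x 0 a] by (auto simp: one)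
    next
      case (Suc l)
      have "(\<integral>\<^sup>+y. emeasure (chain_measure C y) {v. \<forall>k<m. v k = a (Suc k)} \<partial>step_pmf C x) =
        (\<integral>\<^sup>+y. (\<Prod>i<l. ennreal (pmf (step_pmf C (a (Suc i))) (a (Suc (Suc i))))) * indicator {a (Suc 0)} y \<partial>step_pmf C x)"
        unfolding Suc
        using emeasure_chain_measure_prefix[of C _ l "\<lambda>i. a (Suc i)"]
        by (intro nn_integral_cong) (auto simp: indicator_def)
      also have "\<dots> = (\<Prod>i<l. ennreal (pmf (step_pmf C (a (Suc i))) (a (Suc (Suc i))))) * ennreal (pmf (step_pmf C x) (a (Suc 0)))"
        by (subst nn_integral_cmult_indicator) (simp_all add: emeasure_pmf_single)
      finally have int: "(\<integral>\<^sup>+y. emeasure (chain_measure C y) {v. \<forall>k<m. v k = a (Suc k)} \<partial>step_pmf C x) =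
        (\<Prod>i<l. ennreal (pmf (step_pmf C (a (Suc i))) (a (Suc (Suc i))))) * ennreal (pmf (step_pmf C x) (a (Suc 0)))" .
      have "emeasure (chain_measure C x) {v. \<forall>k<n. v k = a k} =
          indicator {x} (a 0) * (\<Prod>i<Suc l. ennreal (pmf (step_pmf C (a i)) (a (Suc i))))"
        unfolding \<open>n = Suc m\<close> Suc by (rule emeasure_chain_measure_prefix)
      then show ?thesis
        unfolding Q shift using int
        by (auto simp: indicator_def prod.lessThan_Suc_shift mult.commute simp del: prod.lessThan_Suc)
    qed
  qed
qed (rule sets_chain_measure)

text \<open>\<open>path_prob\<close> measures an image, which need not be measurable for a general
  map. Here it is the set of trajectories that avoid \<open>None\<close> and decode into
  \<open>E\<close>, hence given by a preimage.\<close>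

lemma sets_Some_image:
  assumes "E \<in> sets word_space"
  shows "(\<circ>) Some ` E \<in> sets word_space"
proof -
  have "(\<circ>) Some ` E = {\<omega> \<in> space word_space. (\<forall>i. \<omega> i \<noteq> None) \<and> (\<lambda>i. the (\<omega> i)) \<in> E}"
  proof (intro Set.set_eqI iffI)
    fix \<omega> assume "\<omega> \<in> {\<omega> \<in> space word_space. (\<forall>i. \<omega> i \<noteq> None) \<and> (\<lambda>i. the (\<omega> i)) \<in> E}"
    then show "\<omega> \<in> (\<circ>) Some ` E"
      by (intro image_eqI[of _ _ "\<lambda>i. the (\<omega> i)"]) auto
  qed (auto simp: space_word_space comp_def)
  also have "\<dots> \<in> sets word_space"
  proof -
    have [measurable]: "(\<lambda>\<omega> i. the (\<omega> i)) \<in> measurable word_space (word_space :: (nat \<Rightarrow> 'a) measure)"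
    proof (rule measurable_PiM_single')
      fix i :: nat
      show "(\<lambda>\<omega>. the (\<omega> i)) \<in> measurable word_space (count_space UNIV)"
        by (rule measurable_compose[OF measurable_component_singleton]) simp_all
    qed (simp add: space_PiM)
    note assms[measurable]
    show ?thesis
      by measurable
  qed
  finally show ?thesis .
qed

lemma path_prob_nonneg: "0 \<le> path_prob C s E"
  by (simp add: path_prob_def)

lemma path_prob_first_step:
  assumes C: "is_dtmc C" and E: "E \<in> sets word_space"
  shows "path_prob C s E = (\<Sum>s'\<in>UNIV. dtmc_trans C s s' * path_prob C s' {w. case_nat s w \<in> E})"
proof -
  let ?I = "\<lambda>E. (\<circ>) Some ` E"
  let ?E' = "{w. case_nat s w \<in> E}"
  have fin: "finite_measure (path_measure C s)" for s
    by (simp add: prob_space_path_measure prob_space.finite_measure)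
  have vim: "{\<omega>. case_nat (Some s) \<omega> \<in> ?I E} = ?I ?E'"
  proof (intro Set.set_eqI iffI)
    fix \<omega> assume "\<omega> \<in> {\<omega>. case_nat (Some s) \<omega> \<in> ?I E}"
    then obtain w where w: "w \<in> E" "case_nat (Some s) \<omega> = Some \<circ> w"
      by auto
    have "\<omega> i = Some (w (Suc i))" for i
      using fun_cong[OF w(2), of "Suc i"] by simp
    moreover have "case_nat s (\<lambda>i. w (Suc i)) = w"
      using fun_cong[OF w(2), of 0] by (auto simp: fun_eq_iff split: nat.split)
    ultimately show "\<omega> \<in> ?I ?E'"
      using w(1) by (intro image_eqI[of _ _ "\<lambda>i. w (Suc i)"]) auto
  next
    fix \<omega> assume "\<omega> \<in> ?I ?E'"
    then obtain w where w: "case_nat s w \<in> E" "\<omega> = Some \<circ> w"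
      by auto
    then have "case_nat (Some s) \<omega> = Some \<circ> case_nat s w"
      by (auto simp: fun_eq_iff split: nat.split)
    with w(1) show "\<omega> \<in> {\<omega>. case_nat (Some s) \<omega> \<in> ?I E}"
      by auto
  qed
  have IE: "?I E \<in> sets word_space"
    using E by (rule sets_Some_image)
  have "emeasure (path_measure C s) (?I E) = emeasure (chain_measure C (Some s)) (?I E)"
    by (simp add: chain_measure_def)
  also have "\<dots> = (\<integral>\<^sup>+y. emeasure (chain_measure C y) {\<omega>. case_nat (Some s) \<omega> \<in> ?I E} \<partial>step_pmf C (Some s))"
    using IE measurable_case_nat_word_space[of "Some s"]
    by (subst chain_measure_first_step)
      (simp add: emeasure_bind[OF _ chain_measure_kernel] emeasure_distr space_chain_measure
        measurable_cong_sets[OF sets_chain_measure refl] vimage_def)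
  also have "\<dots> = (\<Sum>y\<in>UNIV. emeasure (chain_measure C y) {\<omega>. case_nat (Some s) \<omega> \<in> ?I E} * pmf (step_pmf C (Some s)) y)"
    by (rule nn_integral_measure_pmf_support) auto
  also have "\<dots> = (\<Sum>s'\<in>UNIV. emeasure (path_measure C s') (?I ?E') * dtmc_trans C s s') +
      emeasure (return word_space (\<lambda>_. None)) (?I ?E') * pmf (step_pmf C (Some s)) None"
    unfolding vim by (simp add: UNIV_option_conv sum.reindex chain_measure_def pmf_step_pmf[OF C] add.commute)
  \<comment> \<open>The absorbed trajectory is not a word, so the completing mass contributes
    nothing.\<close>
  also have "emeasure (return word_space (\<lambda>_. None)) (?I ?E') = 0"
  proof -
    have "?I ?E' \<in> sets word_space"
      using measurable_sets[OF measurable_case_nat_word_space[of s] E]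
      by (intro sets_Some_image) (simp add: vimage_def space_word_space)
    moreover have "(\<lambda>_. None) \<notin> ?I ?E'"
      by (auto simp: fun_eq_iff)
    ultimately show ?thesis
      by simp
  qed
  finally have "emeasure (path_measure C s) (?I E) =
    (\<Sum>s'\<in>UNIV. emeasure (path_measure C s') (?I ?E') * dtmc_trans C s s') + 0 * ennreal (pmf (step_pmf C (Some s)) None)" .
  then have eq: "ennreal (path_prob C s E) = ennreal (\<Sum>s'\<in>UNIV. dtmc_trans C s s' * path_prob C s' ?E')"
    using C unfolding is_dtmc_def finite_measure.emeasure_eq_measure[OF fin] path_prob_def[symmetric]
    by (simp add: ennreal_mult'[symmetric] ennreal_mult''[symmetric] sum_nonneg path_prob_nonneg mult.commute)
  have "0 \<le> (\<Sum>s'\<in>UNIV. dtmc_trans C s s' * path_prob C s' ?E')"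
    using C unfolding is_dtmc_def by (intro sum_nonneg mult_nonneg_nonneg path_prob_nonneg) auto
  with eq show ?thesis
    by (simp add: ennreal_inj path_prob_nonneg)
qed

section \<open>Restriction of the chain to a set of states\<close>

lemma is_dtmc_restrict_dtmc:
  assumes "is_dtmc C"
  shows "is_dtmc (restrict_dtmc C S')"
proof -
  have "(\<Sum>s'\<in>UNIV. dtmc_trans (restrict_dtmc C S') s s') \<le> (\<Sum>s'\<in>UNIV. dtmc_trans C s s')" for s
    using assms by (intro sum_mono) (auto simp: restrict_dtmc_def is_dtmc_def)
  moreover have "(\<Sum>s'\<in>UNIV. dtmc_trans C s s') \<le> 1" for s
    using assms by (simp add: is_dtmc_def)
  ultimately have "(\<Sum>s'\<in>UNIV. dtmc_trans (restrict_dtmc C S') s s') \<le> 1" for s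
    by (rule order_trans)
  then show ?thesis
    using assms unfolding is_dtmc_def by (simp add: restrict_dtmc_def)
qed

text \<open>Transitions inside \<open>S'\<close> have the same probability in both chains, so the
  laws agree on prefixes inside \<open>S'\<close> and, by continuity from above, on trajectories
  inside \<open>S'\<close>. Indicator densities turn this into an equality of measures, which
  cylinders decide.\<close>

lemma emeasure_path_measure_restrict_dtmc:
  assumes C: "is_dtmc C"
  shows "density (path_measure (restrict_dtmc C S') s) (indicator {\<omega>. \<forall>i. \<omega> i \<in> Some ` S'}) =
    density (path_measure C s) (indicator {\<omega>. \<forall>i. \<omega> i \<in> Some ` S'})"
    (is "density ?M' (indicator ?H) = density ?M (indicator ?H)")
proof (rule measure_eqI_prefix_cylinders)
  have H: "?H \<in> sets word_space"
  proof -
    have "?H = (\<Inter>i. {\<omega>. \<omega> i \<in> Some ` S'})"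
      by auto
    also have "\<dots> \<in> sets word_space"
    proof (intro sets.countable_INT)
      show "range (\<lambda>i. {\<omega> :: nat \<Rightarrow> 'a option. \<omega> i \<in> Some ` S'}) \<subseteq> sets word_space"
        using sets_finite_prefix[of "Suc i" "\<lambda>\<omega>. \<omega> i \<in> Some ` S'" for i] by auto
    qed simp
    finally show ?thesis .
  qed
  show "sets (density ?M' (indicator ?H)) = sets word_space"
    and "sets (density ?M (indicator ?H)) = sets word_space"
    by (simp_all add: sets_path_measure)
  show "finite_measure (density ?M' (indicator ?H))"
    using H by (intro finite_measure.finite_measure_restricted)
      (simp_all add: sets_path_measure prob_space_path_measure prob_space.finite_measure)
  fix n and a :: "nat \<Rightarrow> 'a option"
  let ?cyl = "{v. \<forall>k<n. v k = a k}"
  \<comment> \<open>A decreasing approximation that asks only the first \<open>n + m + 1\<close>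
    states to lie in \<open>S'\<close>. The summand 1 fits the successor form of
    \<open>emeasure_chain_measure_prefix\<close>.\<close>
  define G where "G m = {\<omega>. (\<forall>k<n + m + 1. \<omega> k \<in> Some ` S') \<and> (\<forall>k<n. \<omega> k = a k)}" for m
  have G_sets: "G m \<in> sets word_space" for m
    unfolding G_def by (rule sets_finite_prefix[of "n + m + 1"]) auto
  have Int: "?H \<inter> ?cyl = (\<Inter>m. G m)"
    by (auto simp: G_def) (metis less_add_Suc2 add.commute)
  have "decseq G"
    by (auto simp: decseq_def G_def)
  have INF: "emeasure (path_measure C' s) (?H \<inter> ?cyl) = (INF m. emeasure (path_measure C' s) (G m))" for C'
    unfolding Int using \<open>decseq G\<close> G_sets
    by (intro INF_emeasure_decseq[symmetric])
      (auto simp: sets_path_measure prob_space_path_measure prob_space.finite_measure finite_measure.emeasure_finite)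
  have "emeasure ?M' (G m) = emeasure ?M (G m)" for m
    unfolding G_def
  proof (rule emeasure_eq_finite_prefix[OF sets_path_measure sets_path_measure])
    fix w w' :: "nat \<Rightarrow> 'a option" assume "\<And>k. k < n + m + 1 \<Longrightarrow> w k = w' k"
    then show "((\<forall>k<n + m + 1. w k \<in> Some ` S') \<and> (\<forall>k<n. w k = a k)) =
        ((\<forall>k<n + m + 1. w' k \<in> Some ` S') \<and> (\<forall>k<n. w' k = a k))"
      by auto
  next
    fix w assume w: "(\<forall>k<n + m + 1. w k \<in> Some ` S') \<and> (\<forall>k<n. w k = a k)"
    have "pmf (step_pmf (restrict_dtmc C S') (w i)) (w (Suc i)) = pmf (step_pmf C (w i)) (w (Suc i))"
      if "i < n + m" for i
    proof -
      have "w i \<in> Some ` S'" "w (Suc i) \<in> Some ` S'"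
        using w that by auto
      then show ?thesis
        using pmf_step_pmf(1)[OF C] pmf_step_pmf(1)[OF is_dtmc_restrict_dtmc[OF C]]
        by (auto simp: restrict_dtmc_def)
    qed
    then show "emeasure ?M' {v. \<forall>k<n + m + 1. v k = w k} = emeasure ?M {v. \<forall>k<n + m + 1. v k = w k}"
      using emeasure_chain_measure_prefix[of "restrict_dtmc C S'" "Some s" "n + m" w]
        emeasure_chain_measure_prefix[of C "Some s" "n + m" w]
      by (simp add: chain_measure_def)
  qed
  then show "emeasure (density ?M' (indicator ?H)) ?cyl = emeasure (density ?M (indicator ?H)) ?cyl"
    using H sets_prefix_cylinder[of n a]
    by (simp add: emeasure_restricted sets_path_measure INF)
qed

lemma path_prob_restrict_dtmc:
  assumes C: "is_dtmc C" and E: "E \<in> sets word_space"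
  shows "path_prob (restrict_dtmc C S') s E = path_prob C s (E \<inter> {w. \<forall>i. w i \<in> S'})"
proof -
  let ?I = "(\<circ>) Some ` E" and ?H = "{\<omega>. \<forall>i. \<omega> i \<in> Some ` S'}" and ?C' = "restrict_dtmc C S'"
  \<comment> \<open>In the restricted chain a state outside \<open>S'\<close> has no transition to a
    genuine state, so this event is null. Detecting the violation by the following step also covers
    a start state outside \<open>S'\<close>, where the trajectory begins almost surely.\<close>
  define Z where "Z i = {\<omega> :: nat \<Rightarrow> 'a option. \<omega> i \<in> Some ` (- S') \<and> \<omega> (Suc i) \<in> range Some}" for i
  have C': "is_dtmc ?C'"
    by (rule is_dtmc_restrict_dtmc[OF C])
  have I: "?I \<in> sets word_space"
    by (rule sets_Some_image[OF E])
  have H: "?H \<in> sets word_space"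
  proof -
    have "?H = (\<circ>) Some ` {w. \<forall>i. w i \<in> S'}"
    proof (intro Set.set_eqI iffI)
      fix \<omega> assume "\<omega> \<in> ?H"
      then show "\<omega> \<in> (\<circ>) Some ` {w. \<forall>i. w i \<in> S'}"
        by (intro image_eqI[of _ _ "\<lambda>i. the (\<omega> i)"]) (auto simp: fun_eq_iff image_iff, (metis option.sel)+)
    qed auto
    also have "\<dots> \<in> sets word_space"
      by (rule sets_Some_image[OF sets_stay])
    finally show ?thesis .
  qed
  have Z: "Z i \<in> null_sets (path_measure ?C' s)" for i
  proof (rule null_setsI)
    have prefix: "(\<And>k. k < Suc (Suc i) \<Longrightarrow> w k = w' k) \<Longrightarrow>
        (w i \<in> Some ` (- S') \<and> w (Suc i) \<in> range Some) = (w' i \<in> Some ` (- S') \<and> w' (Suc i) \<in> range Some)"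
      for w w' :: "nat \<Rightarrow> 'a option"
      by simp
    show "Z i \<in> sets (path_measure ?C' s)"
      unfolding Z_def sets_path_measure by (rule sets_finite_prefix[OF prefix])
    \<comment> \<open>Comparison with the null measure reduces the claim to the cylinders that make
      up \<open>Z i\<close>.\<close>
    have "emeasure (path_measure ?C' s) (Z i) = emeasure (null_measure (path_measure ?C' s)) (Z i)"
      unfolding Z_def
    proof (rule emeasure_eq_finite_prefix[OF sets_path_measure _ prefix])
      fix w assume w: "w i \<in> Some ` (- S') \<and> w (Suc i) \<in> range Some"
      then have "pmf (step_pmf ?C' (w i)) (w (Suc i)) = 0"
        using pmf_step_pmf(1)[OF C'] by (auto simp: restrict_dtmc_def)
      then have "(\<Prod>j<Suc i. ennreal (pmf (step_pmf ?C' (w j)) (w (Suc j)))) = 0"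
        by simp
      then show "emeasure (path_measure ?C' s) {v. \<forall>k<Suc (Suc i). v k = w k} =
          emeasure (null_measure (path_measure ?C' s)) {v. \<forall>k<Suc (Suc i). v k = w k}"
        using emeasure_chain_measure_prefix[of ?C' "Some s" "Suc i" w] by (simp add: chain_measure_def)
    qed (simp add: sets_path_measure)
    then show "emeasure (path_measure ?C' s) (Z i) = 0"
      by simp
  qed
  have "?I - ?H \<subseteq> (\<Union>i. Z i)"
    by (auto simp: Z_def image_iff)
  moreover have "(\<Union>i. Z i) \<in> null_sets (path_measure ?C' s)"
    using Z by (rule null_sets_UN)
  ultimately have null: "?I - ?H \<in> null_sets (path_measure ?C' s)"
    using I H by (elim null_sets_subset) (auto simp: sets_path_measure)
  have "emeasure (path_measure ?C' s) ?I = emeasure (path_measure ?C' s) ((?I \<inter> ?H) \<union> (?I - ?H))"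
    by (rule arg_cong[where f = "emeasure _"]) auto
  also have "\<dots> = emeasure (path_measure ?C' s) (?I \<inter> ?H)"
    using I H null by (intro emeasure_Un_null_set) (auto simp: sets_path_measure)
  also have "\<dots> = emeasure (density (path_measure ?C' s) (indicator ?H)) ?I"
    using I H by (simp add: emeasure_restricted sets_path_measure Int_commute)
  also have "\<dots> = emeasure (path_measure C s) (?I \<inter> ?H)"
    unfolding emeasure_path_measure_restrict_dtmc[OF C]
    using I H by (simp add: emeasure_restricted sets_path_measure Int_commute)
  also have "?I \<inter> ?H = (\<circ>) Some ` (E \<inter> {w. \<forall>i. w i \<in> S'})"
    by (auto simp: inj_image_mem_iff intro!: imageI)
  finally show ?thesis
    by (simp only: path_prob_def measure_def)
qed

section \<open>Values of the product\<close>

lemma accepting_run_case_nat: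
  "accepting_run A q (case_nat s w) r \<longleftrightarrow>
    r 0 = q \<and> r (Suc 0) \<in> buchi_delta A q s \<and> accepting_run A (r (Suc 0)) w (\<lambda>i. r (Suc i))"
proof -
  have "(\<exists>\<^sub>\<infinity>i. r i \<in> buchi_acc A) \<longleftrightarrow> (\<exists>\<^sub>\<infinity>i. r (Suc i) \<in> buchi_acc A)"
    unfolding frequently_def by (simp only: MOST_Suc_iff[of "\<lambda>i. r i \<notin> buchi_acc A"])
  moreover have "(\<forall>i. r (Suc i) \<in> buchi_delta A (r i) (case_nat s w i)) \<longleftrightarrow>
      r (Suc 0) \<in> buchi_delta A (r 0) s \<and> (\<forall>i. r (Suc (Suc i)) \<in> buchi_delta A (r (Suc i)) (w i))"
    (is "(\<forall>i. ?P i) \<longleftrightarrow> _ \<and> (\<forall>i. ?P' i)")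
  proof
    assume "\<forall>i. ?P i"
    from spec[OF this, of 0] spec[OF this, of "Suc i" for i]
    show "r (Suc 0) \<in> buchi_delta A (r 0) s \<and> (\<forall>i. ?P' i)"
      by simp
  next
    assume r: "r (Suc 0) \<in> buchi_delta A (r 0) s \<and> (\<forall>i. ?P' i)"
    show "\<forall>i. ?P i"
    proof
      show "?P i" for i
        using r by (cases i) auto
    qed
  qed
  ultimately show ?thesis
    by (auto simp: accepting_run_def)
qed

lemma accepting_run_Cons:
  assumes "q' \<in> buchi_delta A q s" "accepting_run A q' w r"
  shows "accepting_run A q (case_nat s w) (case_nat q r)"
proof -
  have "r 0 = q'"
    using assms(2) by (simp add: accepting_run_def)
  with assms show ?thesis
    by (simp add: accepting_run_case_nat)
qed

lemma language_case_nat: "{w. case_nat s w \<in> language A q} = (\<Union>q'\<in>buchi_delta A q s. language A q')"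
proof (intro Set.set_eqI iffI)
  fix w assume "w \<in> (\<Union>q'\<in>buchi_delta A q s. language A q')"
  then obtain q' r where "q' \<in> buchi_delta A q s" "accepting_run A q' w r"
    by (auto simp: language_def)
  from accepting_run_Cons[OF this] show "w \<in> {w. case_nat s w \<in> language A q}"
    by (auto simp: language_def)
next
  fix w assume "w \<in> {w. case_nat s w \<in> language A q}"
  then obtain r where "r (Suc 0) \<in> buchi_delta A q s" "accepting_run A (r (Suc 0)) w (\<lambda>i. r (Suc i))"
    by (auto simp: language_def accepting_run_case_nat)
  then show "w \<in> (\<Union>q'\<in>buchi_delta A q s. language A q')"
    by (auto simp: language_def)
qed

text \<open>\<open>unambiguous\<close> constrains the initial state only; this form passes to
  successors and thus reaches every product state reachable from the initial one.\<close>

definition unambiguous_from :: "('q, 's) buchi \<Rightarrow> 'q \<Rightarrow> bool" where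
  "unambiguous_from A q \<longleftrightarrow> (\<forall>w r r'. accepting_run A q w r \<and> accepting_run A q w r' \<longrightarrow> r = r')"

lemma unambiguous_from_delta:
  assumes "unambiguous_from A q" "q' \<in> buchi_delta A q s"
  shows "unambiguous_from A q'"
  unfolding unambiguous_from_def
proof (intro allI impI)
  fix w r r' assume "accepting_run A q' w r \<and> accepting_run A q' w r'"
  then have "case_nat q r = case_nat q r'"
    using assms accepting_run_Cons unfolding unambiguous_from_def by metis
  then show "r = r'"
    by (metis (no_types, lifting) ext old.nat.simps(5))
qed

text \<open>A word accepted from two successors would, prefixed by \<open>s\<close>, have two
  accepting runs from \<open>q\<close> that differ at position 1.\<close>

lemma disjoint_family_on_language:
  assumes "unambiguous_from A q"
  shows "disjoint_family_on (language A) (buchi_delta A q s)"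
  unfolding disjoint_family_on_def
proof (intro ballI impI)
  fix q\<^sub>1 q\<^sub>2 assume q: "q\<^sub>1 \<in> buchi_delta A q s" "q\<^sub>2 \<in> buchi_delta A q s" "q\<^sub>1 \<noteq> q\<^sub>2"
  show "language A q\<^sub>1 \<inter> language A q\<^sub>2 = {}"
  proof (rule ccontr)
    assume "language A q\<^sub>1 \<inter> language A q\<^sub>2 \<noteq> {}"
    then obtain w r\<^sub>1 r\<^sub>2 where r: "accepting_run A q\<^sub>1 w r\<^sub>1" "accepting_run A q\<^sub>2 w r\<^sub>2"
      by (auto simp: language_def)
    then have "case_nat q r\<^sub>1 = case_nat q r\<^sub>2"
      using assms accepting_run_Cons[OF q(1)] accepting_run_Cons[OF q(2)] unfolding unambiguous_from_def by metis
    from fun_cong[OF this, of "Suc 0"] r q(3) show False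
      by (simp add: accepting_run_def)
  qed
qed

text \<open>Words from \<open>s\<close> almost surely have first letter \<open>s\<close>, so a set
  without such words is null.\<close>

lemma path_prob_eq_0_if_no_successor:
  assumes "is_dtmc C" "E \<in> sets word_space" "{w. case_nat s w \<in> E} = {}"
  shows "path_prob C s E = 0"
proof -
  have "path_prob C s {} = 0" for s
    by (simp add: path_prob_def)
  then show ?thesis
    unfolding path_prob_first_step[OF assms(1,2)] assms(3) by simp
qed

section \<open>Monotonicity and additivity of path probabilities\<close>

lemma path_prob_mono:
  assumes "E \<subseteq> F" "F \<in> sets word_space"
  shows "path_prob C s E \<le> path_prob C s F"
  unfolding path_prob_def using assms
  by (intro finite_measure.finite_measure_mono prob_space.finite_measure[OF prob_space_path_measure] image_mono)
    (simp_all add: sets_path_measure sets_Some_image)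

lemma path_prob_le_1: "path_prob C s E \<le> 1"
  unfolding path_prob_def by (rule prob_space.prob_le_1[OF prob_space_path_measure])

lemma path_prob_UN_le:
  assumes "finite I" "\<And>i. i \<in> I \<Longrightarrow> E i \<in> sets word_space"
  shows "path_prob C s (\<Union>i\<in>I. E i) \<le> (\<Sum>i\<in>I. path_prob C s (E i))"
  unfolding path_prob_def image_UN using assms
  by (intro finite_measure.finite_measure_subadditive_finite prob_space.finite_measure[OF prob_space_path_measure])
    (auto simp: sets_path_measure sets_Some_image)

lemma path_prob_UN_disjoint:
  fixes C :: "'s::finite dtmc" and E :: "'i \<Rightarrow> (nat \<Rightarrow> 's) set"
  assumes "finite I" "\<And>i. i \<in> I \<Longrightarrow> E i \<in> sets word_space" "disjoint_family_on E I"
  shows "path_prob C s (\<Union>i\<in>I. E i) = (\<Sum>i\<in>I. path_prob C s (E i))"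
proof -
  have "inj ((\<circ>) Some :: (nat \<Rightarrow> 's) \<Rightarrow> _)"
    by (auto simp: inj_on_def fun_eq_iff)
  then have "disjoint_family_on (\<lambda>i. (\<circ>) Some ` E i) I"
    using assms(3) unfolding disjoint_family_on_def image_Int[OF \<open>inj _\<close>, symmetric] by simp
  then show ?thesis
    unfolding path_prob_def image_UN using assms(1,2)
    by (intro finite_measure.finite_measure_finite_Union prob_space.finite_measure[OF prob_space_path_measure])
      (auto simp: sets_path_measure sets_Some_image)
qed

lemma path_prob_UN_eq_0:
  fixes E :: "nat \<Rightarrow> (nat \<Rightarrow> 's::finite) set"
  assumes "\<And>n. E n \<in> sets word_space" "\<And>n. path_prob C s (E n) = 0"
  shows "path_prob C s (\<Union>n. E n) = 0"
proof -
  have "(\<Union>n. (\<circ>) Some ` E n) \<in> null_sets (path_measure C s)"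
    using assms unfolding path_prob_def
    by (intro null_sets_UN null_setsI)
      (auto simp: sets_path_measure sets_Some_image
        finite_measure.emeasure_eq_measure[OF prob_space.finite_measure[OF prob_space_path_measure]])
  then show ?thesis
    unfolding path_prob_def image_UN by (simp add: measure_eq_0_null_sets)
qed

lemma path_prob_Int_Diff:
  assumes "E \<in> sets word_space" "G \<in> sets word_space"
  shows "path_prob C s E = path_prob C s (E \<inter> G) + path_prob C s (E - G)"
proof -
  have "path_prob C s (\<Union>b\<in>UNIV. if b then E \<inter> G else E - G) = (\<Sum>b\<in>UNIV. path_prob C s (if b then E \<inter> G else E - G))"
    using assms by (intro path_prob_UN_disjoint) (auto simp: disjoint_family_on_def)
  moreover have "(\<Union>b\<in>UNIV. if b then E \<inter> G else E - G) = E"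
    by (auto simp: UNIV_bool)
  ultimately show ?thesis
    by (simp add: UNIV_bool)
qed

lemma sum_product_matrix:
  fixes C :: "'s::finite dtmc" and A :: "('q::finite, 's) buchi"
  shows "(\<Sum>p'\<in>UNIV. product_matrix C A (s, q) p' * f p') =
    (\<Sum>s'\<in>UNIV. dtmc_trans C s s' * (\<Sum>q'\<in>buchi_delta A q s. f (s', q')))"
proof -
  have "(\<Sum>p'\<in>UNIV. product_matrix C A (s, q) p' * f p') =
    (\<Sum>s'\<in>UNIV. \<Sum>q'\<in>UNIV. product_matrix C A (s, q) (s', q') * f (s', q'))"
    unfolding sum.cartesian_product by (simp add: case_prod_unfold)
  also have "\<dots> = (\<Sum>s'\<in>UNIV. \<Sum>q'\<in>UNIV. if q' \<in> buchi_delta A q s then dtmc_trans C s s' * f (s', q') else 0)"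
    by (intro sum.cong refl) (simp add: product_matrix_def)
  also have "\<dots> = (\<Sum>s'\<in>UNIV. dtmc_trans C s s' * (\<Sum>q'\<in>buchi_delta A q s. f (s', q')))"
    by (simp add: sum.If_cases sum_distrib_left)
  finally show ?thesis .
qed

text \<open>The successor languages cover the residual language, which gives the inequality;
  unambiguity makes them disjoint, which gives equality. \<open>G'\<close> is what remains of
  \<open>G\<close> after one letter: \<open>G\<close> itself for staying in \<open>S'\<close>, a
  shorter deadline for leaving \<open>S'\<close>.\<close>

lemma path_prob_language_step:
  fixes C :: "'s::finite dtmc" and A :: "('q::finite, 's) buchi"
  assumes C: "is_dtmc C" and G: "G \<in> sets word_space" "G' \<in> sets word_space" "{w. case_nat s w \<in> G} = G'"
  shows "path_prob C s (language A q \<inter> G) \<le>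
      (\<Sum>p'\<in>UNIV. product_matrix C A (s, q) p' * path_prob C (fst p') (language A (snd p') \<inter> G'))"
    and "unambiguous_from A q \<Longrightarrow> path_prob C s (language A q \<inter> G) =
      (\<Sum>p'\<in>UNIV. product_matrix C A (s, q) p' * path_prob C (fst p') (language A (snd p') \<inter> G'))"
proof -
  have "{w. case_nat s w \<in> language A q \<inter> G} = (\<Union>q'\<in>buchi_delta A q s. language A q' \<inter> G')"
    using language_case_nat[of s A q] G(3) by blast
  then have step: "path_prob C s (language A q \<inter> G) =
      (\<Sum>s'\<in>UNIV. dtmc_trans C s s' * path_prob C s' (\<Union>q'\<in>buchi_delta A q s. language A q' \<inter> G'))"
    using path_prob_first_step[OF C sets.Int[OF sets_language G(1)], of s A q] by simp
  have P: "0 \<le> dtmc_trans C s s'" for s'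
    using C by (simp add: is_dtmc_def)
  show "path_prob C s (language A q \<inter> G) \<le>
      (\<Sum>p'\<in>UNIV. product_matrix C A (s, q) p' * path_prob C (fst p') (language A (snd p') \<inter> G'))"
    unfolding step sum_product_matrix fst_conv snd_conv
    by (intro sum_mono mult_left_mono path_prob_UN_le P sets.Int sets_language G) simp
  show "path_prob C s (language A q \<inter> G) =
      (\<Sum>p'\<in>UNIV. product_matrix C A (s, q) p' * path_prob C (fst p') (language A (snd p') \<inter> G'))"
    if "unambiguous_from A q"
  proof -
    have "disjoint_family_on (\<lambda>q'. language A q' \<inter> G') (buchi_delta A q s)"
      using disjoint_family_on_language[OF that, of s] by (auto simp: disjoint_family_on_def)
    then have "path_prob C s' (\<Union>q'\<in>buchi_delta A q s. language A q' \<inter> G') =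
        (\<Sum>q'\<in>buchi_delta A q s. path_prob C s' (language A q' \<inter> G'))" for s'
      by (intro path_prob_UN_disjoint sets.Int sets_language G) simp_all
    then show ?thesis
      unfolding step sum_product_matrix by simp
  qed
qed

text \<open>
  The probability that the \<open>n\<close>-th state of the chain from \<open>s\<close> is \<open>s'\<close> and that the first \<open>n\<close> states followed
  by the fixed word \<open>t\<close> lie in \<open>X\<close>. For \<open>X = language A q\<close> unambiguity lets it count, with weights, the
  finite runs from \<open>q\<close> that end in a state accepting \<open>t\<close>, which bounds the powers of \<open>B\<close>.
\<close>

primrec grafted_prob :: "'s::finite dtmc \<Rightarrow> 's \<Rightarrow> (nat \<Rightarrow> 's) \<Rightarrow> nat \<Rightarrow> 's \<Rightarrow> (nat \<Rightarrow> 's) set \<Rightarrow> real" where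
  "grafted_prob C s' t 0 s X = of_bool (s = s' \<and> t \<in> X)"
| "grafted_prob C s' t (Suc n) s X =
    (\<Sum>s\<^sub>1\<in>UNIV. dtmc_trans C s s\<^sub>1 * grafted_prob C s' t n s\<^sub>1 {w. case_nat s w \<in> X})"

lemma grafted_prob_le_1:
  assumes "is_dtmc C"
  shows "grafted_prob C s' t n s X \<le> 1"
proof (induction n arbitrary: s X)
  case (Suc n)
  have "grafted_prob C s' t (Suc n) s X \<le> (\<Sum>s\<^sub>1\<in>UNIV. dtmc_trans C s s\<^sub>1 * 1)"
    unfolding grafted_prob.simps using assms
    by (intro sum_mono mult_left_mono Suc.IH) (simp add: is_dtmc_def)
  also have "\<dots> \<le> 1"
    using assms by (simp add: is_dtmc_def)
  finally show ?case .
qed simp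

lemma grafted_prob_UN_disjoint:
  assumes "finite I" "disjoint_family_on E I"
  shows "grafted_prob C s' t n s (\<Union>i\<in>I. E i) = (\<Sum>i\<in>I. grafted_prob C s' t n s (E i))"
  using assms(2)
proof (induction n arbitrary: s E)
  case 0
  show ?case
  proof (cases "\<exists>i\<in>I. t \<in> E i")
    case True
    then obtain i where i: "i \<in> I" "t \<in> E i"
      by blast
    then have "t \<in> E j \<longleftrightarrow> j = i" if "j \<in> I" for j
      using 0 that unfolding disjoint_family_on_def by blast
    then have "(\<Sum>j\<in>I. grafted_prob C s' t 0 s (E j)) = (\<Sum>j\<in>I. if j = i then of_bool (s = s') else 0)"
      by (intro sum.cong) auto
    with i assms(1) show ?thesis
      by auto
  next
    case False
    then show ?thesis
      by (auto intro!: sum.neutral)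
  qed
next
  case (Suc n)
  have "disjoint_family_on (\<lambda>i. {w. case_nat s w \<in> E i}) I"
    using Suc.prems unfolding disjoint_family_on_def by blast
  moreover have "{w. case_nat s w \<in> (\<Union>i\<in>I. E i)} = (\<Union>i\<in>I. {w. case_nat s w \<in> E i})"
    by blast
  ultimately have "grafted_prob C s' t (Suc n) s (\<Union>i\<in>I. E i) =
    (\<Sum>s\<^sub>1\<in>UNIV. \<Sum>i\<in>I. dtmc_trans C s s\<^sub>1 * grafted_prob C s' t n s\<^sub>1 {w. case_nat s w \<in> E i})"
    unfolding grafted_prob.simps by (simp only: Suc.IH sum_distrib_left)
  also have "\<dots> = (\<Sum>i\<in>I. grafted_prob C s' t (Suc n) s (E i))"
    by (subst sum.swap) simp
  finally show ?case .
qed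

section \<open>Powers of the product matrix under unambiguity\<close>

lemma product_matrix_nonneg:
  assumes "is_dtmc C"
  shows "0 \<le> product_matrix C A p p'"
  using assms by (auto simp: product_matrix_def is_dtmc_def split: prod.split)

lemma restr_op_funpow_nonneg:
  assumes "\<And>p p'. 0 \<le> B p p'" "\<And>p. 0 \<le> f p"
  shows "0 \<le> (restr_op B D ^^ k) f p"
  using assms by (induction k arbitrary: p) (auto simp: restr_op_def intro!: sum_nonneg)

text \<open>Only an inequality, since runs that leave \<open>D\<close> and runs that end in another
  state accepting \<open>t\<close> are counted on the right alone.\<close>

lemma product_matrix_power_le_grafted_prob:
  fixes C :: "'s::finite dtmc" and A :: "('q::finite, 's) buchi"
  assumes C: "is_dtmc C" and t: "t \<in> language A q'"
  shows "unambiguous_from A q \<Longrightarrow>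
    (restr_op (product_matrix C A) D ^^ n) (indicator {(s', q')}) (s, q) \<le> grafted_prob C s' t n s (language A q)"
proof (induction n arbitrary: s q)
  case 0
  then show ?case
    using t by (auto simp: indicator_def)
next
  case (Suc n)
  let ?B = "product_matrix C A" and ?g = "(restr_op (product_matrix C A) D ^^ n) (indicator {(s', q')})"
  have "(restr_op ?B D ^^ Suc n) (indicator {(s', q')}) (s, q) \<le> (\<Sum>p'\<in>UNIV. ?B (s, q) p' * ?g p')"
    using C product_matrix_nonneg[of C A]
    by (auto simp: restr_op_def intro!: sum_mono2 mult_nonneg_nonneg restr_op_funpow_nonneg)
  also have "\<dots> = (\<Sum>s\<^sub>1\<in>UNIV. dtmc_trans C s s\<^sub>1 * (\<Sum>q\<^sub>1\<in>buchi_delta A q s. ?g (s\<^sub>1, q\<^sub>1)))"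
    by (rule sum_product_matrix)
  also have "\<dots> \<le> (\<Sum>s\<^sub>1\<in>UNIV. dtmc_trans C s s\<^sub>1 * (\<Sum>q\<^sub>1\<in>buchi_delta A q s. grafted_prob C s' t n s\<^sub>1 (language A q\<^sub>1)))"
    using C Suc.prems
    by (intro sum_mono mult_left_mono Suc.IH) (auto simp: is_dtmc_def intro: unambiguous_from_delta)
  also have "\<dots> = grafted_prob C s' t (Suc n) s (language A q)"
    unfolding grafted_prob.simps language_case_nat
    by (simp add: grafted_prob_UN_disjoint disjoint_family_on_language[OF Suc.prems])
  finally show ?case .
qed

lemma edges_product_matrix:
  assumes "((s, q), (s', q')) \<in> edges (product_matrix C A)"
  shows "q' \<in> buchi_delta A q s"
  using assms by (simp add: edges_def product_matrix_def split: if_splits)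

lemma unambiguous_from_rtrancl:
  assumes "(p, p') \<in> (edges (product_matrix C A))\<^sup>*" "unambiguous_from A (snd p)"
  shows "unambiguous_from A (snd p')"
  using assms
proof (induction rule: rtrancl_induct)
  case (step x z)
  then have "snd z \<in> buchi_delta A (snd x) (fst x)"
    by (intro edges_product_matrix[of _ _ "fst z" _ C]) simp
  with step.IH[OF step.prems] show ?case
    by (rule unambiguous_from_delta)
qed simp

text \<open>By strong connectivity this makes emptiness of the language constant on an SCC: one
  state accepting a word suffices for all.\<close>

lemma language_nonempty_rtrancl:
  assumes "(p, p') \<in> (edges (product_matrix C A))\<^sup>*" "language A (snd p') \<noteq> {}"
  shows "language A (snd p) \<noteq> {}"
  using assms
proof (induction rule: converse_rtrancl_induct)
  case (step x z)
  obtain s q s' q' where xz: "x = (s, q)" "z = (s', q')"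
    by (metis surj_pair)
  with step have "((s, q), (s', q')) \<in> edges (product_matrix C A)" "language A q' \<noteq> {}"
    by simp_all
  then have "q' \<in> buchi_delta A q s" "language A q' \<noteq> {}"
    by (blast intro: edges_product_matrix)+
  then have "{w. case_nat s w \<in> language A q} \<noteq> {}"
    unfolding language_case_nat by blast
  with xz show ?case
    by auto
qed simp

text \<open>Each entry of a power is bounded by a grafted probability for some word accepted from
  the target state; nonemptiness supplies that word.\<close>

lemma spectral_radius_product_matrix_le_1:
  fixes C :: "'s::finite dtmc" and A :: "('q::finite, 's) buchi"
  assumes C: "is_dtmc C" and D: "D \<noteq> {}"
    and lang: "\<And>p. p \<in> D \<Longrightarrow> language A (snd p) \<noteq> {}" and unamb: "\<And>p. p \<in> D \<Longrightarrow> unambiguous_from A (snd p)"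
  shows "spectral_radius (submatrix_on (product_matrix C A) D) \<le> 1"
proof (rule spectral_radius_le_1)
  fix k p p' assume p: "p \<in> D" "p' \<in> D"
  obtain s q s' q' where eq: "p = (s, q)" "p' = (s', q')"
    by (metis surj_pair)
  obtain t where "t \<in> language A q'"
    using lang[OF p(2)] eq by auto
  from order_trans[OF product_matrix_power_le_grafted_prob[OF C this] grafted_prob_le_1[OF C]]
  show "(restr_op (product_matrix C A) D ^^ k) (indicator {p'}) p \<le> 1"
    using unamb[OF p(1)] eq by simp
qed (simp_all add: D product_matrix_nonneg[OF C])

text \<open>Take a support point \<open>p\<close> with the fewest reachable points. A support point
  reachable from \<open>p\<close> then has the same reachable set, so it reaches \<open>p\<close>
  back and lies in its SCC. Successors outside \<open>D\<close> therefore carry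
  \<open>y = 0\<close>, and restricting to \<open>D\<close> loses nothing of
  \<open>B y\<close>.\<close>

lemma minimal_support_scc:
  fixes B :: "'i::finite \<Rightarrow> 'i \<Rightarrow> real"
  assumes nonneg: "\<And>p p'. 0 \<le> B p p'" and y: "\<And>p. 0 \<le> y p" "\<And>p. y p \<le> (\<Sum>p'\<in>UNIV. B p p' * y p')"
    and pos: "0 < y p\<^sub>0"
  obtains D p where "D \<in> sccs B" "p \<in> D" "0 < y p" "\<And>p. p \<in> D \<Longrightarrow> y p \<le> restr_op B D y p"
proof -
  let ?R = "\<lambda>p. {j. (p, j) \<in> (edges B)\<^sup>*}"
  define p where "p = arg_min (\<lambda>p. card (?R p)) (\<lambda>p. 0 < y p)"
  have p: "0 < y p"
    unfolding p_def using pos by (rule arg_min_natI)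
  have min: "card (?R p) \<le> card (?R p')" if "0 < y p'" for p'
    unfolding p_def using that by (rule arg_min_nat_le)
  define D where "D = {j. (p, j) \<in> (edges B)\<^sup>* \<and> (j, p) \<in> (edges B)\<^sup>*}"
  have in_D: "p' \<in> D" if "(p, p') \<in> (edges B)\<^sup>*" "0 < y p'" for p'
  proof -
    have "?R p' \<subseteq> ?R p"
      using that(1) by (auto intro: rtrancl_trans)
    then have "?R p' = ?R p"
      using min[OF that(2)] by (intro card_seteq) auto
    then show ?thesis
      using that(1) by (auto simp: D_def)
  qed
  show ?thesis
  proof (rule that[of D p])
    fix j assume j: "j \<in> D"
    have "(\<Sum>p'\<in>UNIV. B j p' * y p') = restr_op B D y j"
      unfolding restr_op_def
    proof (rule sum.mono_neutral_right)
      show "\<forall>p'\<in>UNIV - D. B j p' * y p' = 0"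
      proof (rule ballI, rule ccontr)
        fix p' assume p': "p' \<in> UNIV - D" "B j p' * y p' \<noteq> 0"
        then have "0 < B j p'" "0 < y p'"
          using nonneg[of j p'] y(1)[of p'] by (auto simp: less_le)
        moreover from this(1) have "(p, p') \<in> (edges B)\<^sup>*"
          using j by (auto simp: D_def edges_def intro: rtrancl_into_rtrancl)
        ultimately show False
          using in_D p'(1) by blast
      qed
    qed auto
    with y(2)[of j] show "y j \<le> restr_op B D y j"
      by simp
  qed (use p in \<open>auto simp: D_def sccs_def\<close>)
qed


text \<open>
  The words of the restricted chain are those of \<open>C\<close> that stay in \<open>S'\<close>, so values of both chains can be
  compared under the path measure of \<open>C\<close>.
\<close>

definition safe_value :: "'s::finite dtmc \<Rightarrow> ('q, 's) buchi \<Rightarrow> 's set \<Rightarrow> 's \<times> 'q \<Rightarrow> real" where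
  "safe_value C A S' = (\<lambda>(s, q). path_prob C s (language A q \<inter> {w. \<forall>i. w i \<in> S'}))"

lemma safe_value_restrict_dtmc:
  fixes C :: "'s::finite dtmc" and A :: "('q::finite, 's) buchi"
  assumes "is_dtmc C"
  shows "path_prob (restrict_dtmc C S') s (language A q) = safe_value C A S' (s, q)"
  by (simp add: safe_value_def path_prob_restrict_dtmc[OF assms sets_language])

lemma safe_value_outside:
  fixes C :: "'s::finite dtmc" and A :: "('q::finite, 's) buchi"
  assumes C: "is_dtmc C" and s: "s \<notin> S'"
  shows "safe_value C A S' (s, q) = 0"
proof -
  have "{w. case_nat s w \<in> language A q \<inter> {w. \<forall>i. w i \<in> S'}} = {}"
    using s by (auto intro: exI[of _ 0])
  from path_prob_eq_0_if_no_successor[OF C sets.Int[OF sets_language sets_stay] this] show ?thesis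
    by (simp add: safe_value_def)
qed

text \<open>Off \<open>S'\<close> the value is 0 while the right-hand side may be positive, so
  equality is confined to states in \<open>S'\<close>.\<close>

lemma safe_value_step:
  fixes C :: "'s::finite dtmc" and A :: "('q::finite, 's) buchi"
  assumes C: "is_dtmc C"
  shows "safe_value C A S' p \<le> (\<Sum>p'\<in>UNIV. product_matrix C A p p' * safe_value C A S' p')"
    and "fst p \<in> S' \<Longrightarrow> unambiguous_from A (snd p) \<Longrightarrow>
      safe_value C A S' p = (\<Sum>p'\<in>UNIV. product_matrix C A p p' * safe_value C A S' p')"
proof -
  obtain s q where p: "p = (s, q)"
    by (cases p)
  have shift: "{w. case_nat s w \<in> {w. \<forall>i. w i \<in> S'}} = {w. \<forall>i. w i \<in> S'}" if "s \<in> S'"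
    using that by (auto split: nat.split dest: spec[of _ "Suc i" for i])
  show "safe_value C A S' p \<le> (\<Sum>p'\<in>UNIV. product_matrix C A p p' * safe_value C A S' p')"
  proof (cases "s \<in> S'")
    case True
    from path_prob_language_step(1)[OF C sets_stay sets_stay shift[OF True], of A q] show ?thesis
      by (simp add: p safe_value_def case_prod_unfold)
  next
    case False
    then show ?thesis
      using product_matrix_nonneg[OF C, of A]
      by (simp add: p safe_value_outside[OF C])
        (auto simp: safe_value_def path_prob_nonneg intro!: sum_nonneg mult_nonneg_nonneg)
  qed
  show "safe_value C A S' p = (\<Sum>p'\<in>UNIV. product_matrix C A p p' * safe_value C A S' p')"
    if "fst p \<in> S'" "unambiguous_from A (snd p)"
    using path_prob_language_step(2)[OF C sets_stay sets_stay shift, of A q] that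
    by (simp add: p safe_value_def case_prod_unfold)
qed

lemma value_vec_step:
  fixes C :: "'s::finite dtmc" and A :: "('q::finite, 's) buchi"
  assumes C: "is_dtmc C" and "unambiguous_from A (snd p)"
  shows "value_vec C A p = (\<Sum>p'\<in>UNIV. product_matrix C A p p' * value_vec C A p')"
proof -
  have "value_vec C A = safe_value C A UNIV"
    by (simp add: value_vec_def safe_value_def)
  with safe_value_step(2)[OF C, of p UNIV A] assms(2) show ?thesis
    by simp
qed

lemma safe_value_le_value_vec:
  fixes C :: "'s::finite dtmc" and A :: "('q::finite, 's) buchi"
  shows "safe_value C A S' p \<le> value_vec C A p"
  unfolding safe_value_def value_vec_def
  by (auto split: prod.split intro: path_prob_mono sets_language)

text \<open>
  If \<open>D\<close> carries the full value, words accepted from \<open>D\<close> almost surely have a run in \<open>D\<close>, hence stay in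
  the states of \<open>D\<close>; this is shown for the first \<open>n\<close> states by induction on \<open>n\<close>.
\<close>

lemma safe_value_eq_value_vec:
  fixes C :: "'s::finite dtmc" and A :: "('q::finite, 's) buchi"
  assumes C: "is_dtmc C" and D: "fst ` D \<subseteq> S'"
    and unamb: "\<And>p. p \<in> D \<Longrightarrow> unambiguous_from A (snd p)"
    and inv: "\<And>p. p \<in> D \<Longrightarrow> restr_op (product_matrix C A) D (value_vec C A) p = value_vec C A p"
    and p: "p \<in> D"
  shows "safe_value C A S' p = value_vec C A p"
proof -
  let ?B = "product_matrix C A"
  define G where "G n = {w :: nat \<Rightarrow> 's. \<exists>i\<le>n. w i \<notin> S'}" for n
  have G: "G n \<in> sets word_space" for n
    unfolding G_def by (rule sets_finite_prefix[of "Suc n"]) auto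
  \<comment> \<open>The full sum and the sum over \<open>D\<close> both equal the value, so the
    remaining nonnegative terms vanish: every transition leaving \<open>D\<close> leads to value
    0.\<close>
  have outside: "?B p p' * value_vec C A p' = 0" if "p \<in> D" "p' \<notin> D" for p p'
  proof -
    have "(\<Sum>p'\<in>UNIV. ?B p p' * value_vec C A p') = (\<Sum>p'\<in>D. ?B p p' * value_vec C A p')"
      using value_vec_step[OF C unamb[OF that(1)]] inv[OF that(1)] by (simp add: restr_op_def)
    then have "(\<Sum>p'\<in>- D. ?B p p' * value_vec C A p') = 0"
      using sum.union_disjoint[of D "- D" "\<lambda>p'. ?B p p' * value_vec C A p'"] by simp
    then show ?thesis
      using that(2) product_matrix_nonneg[OF C, of A]
      by (subst (asm) sum_nonneg_eq_0_iff)
        (auto simp: value_vec_def path_prob_nonneg split: prod.split intro!: mult_nonneg_nonneg)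
  qed
  have leave: "path_prob C (fst p) (language A (snd p) \<inter> G n) = 0" if "p \<in> D" for n p
    using that
  proof (induction n arbitrary: p)
    case 0
    have "fst p \<in> S'"
      using 0 D by auto
    then have "{w. case_nat (fst p) w \<in> language A (snd p) \<inter> G 0} = {}"
      by (auto simp: G_def)
    then show ?case
      by (rule path_prob_eq_0_if_no_successor[OF C sets.Int[OF sets_language G]])
  next
    case (Suc n)
    have "fst p \<in> S'"
      using Suc.prems D by auto
    then have "(\<exists>i\<le>Suc n. case_nat (fst p) w i \<notin> S') \<longleftrightarrow> (\<exists>i\<le>n. w i \<notin> S')" for w
      unfolding less_Suc_eq_le[symmetric] using All_less_Suc2[of "Suc n" "\<lambda>i. case_nat (fst p) w i \<in> S'"] by auto
    then have "{w. case_nat (fst p) w \<in> G (Suc n)} = G n"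
      by (simp add: G_def)
    from path_prob_language_step(1)[OF C G G this, of A "snd p"]
    have "path_prob C (fst p) (language A (snd p) \<inter> G (Suc n)) \<le>
        (\<Sum>p'\<in>UNIV. ?B p p' * path_prob C (fst p') (language A (snd p') \<inter> G n))"
      by simp
    also have "\<dots> = 0"
    proof (intro sum.neutral ballI)
      fix p' :: "'s \<times> 'q"
      show "?B p p' * path_prob C (fst p') (language A (snd p') \<inter> G n) = 0"
      proof (cases "p' \<in> D")
        case True
        then show ?thesis
          by (simp add: Suc.IH)
      next
        case False
        have "path_prob C (fst p') (language A (snd p') \<inter> G n) \<le> value_vec C A p'"
          by (auto simp: value_vec_def case_prod_unfold intro: path_prob_mono sets_language)
        moreover have "?B p p' = 0 \<or> value_vec C A p' = 0"
          using outside[OF Suc.prems False] by simp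
        ultimately show ?thesis
          using path_prob_nonneg[of C "fst p'" "language A (snd p') \<inter> G n"] by auto
      qed
    qed
    finally show ?case
      by (rule order_antisym) (rule path_prob_nonneg)
  qed
  obtain s q where sq: "p = (s, q)"
    by (cases p)
  have "language A q - {w. \<forall>i. w i \<in> S'} = (\<Union>n. language A q \<inter> G n)"
  proof (intro Set.set_eqI iffI)
    fix w assume "w \<in> language A q - {w. \<forall>i. w i \<in> S'}"
    then obtain n where "w \<in> language A q" "w n \<notin> S'"
      by blast
    then show "w \<in> (\<Union>n. language A q \<inter> G n)"
      by (intro UN_I[of n]) (auto simp: G_def)
  qed (auto simp: G_def)
  moreover have "path_prob C s (\<Union>n. language A q \<inter> G n) = 0"
    using leave[OF p] sq by (intro path_prob_UN_eq_0 sets.Int sets_language G) simp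
  ultimately show ?thesis
    using path_prob_Int_Diff[OF sets_language sets_stay, of C s A q S']
    by (simp add: sq safe_value_def value_vec_def)
qed

section \<open>Feasible vectors against the restricted value\<close>

lemma value_vec_nonneg: "0 \<le> value_vec C A p"
  by (simp add: value_vec_def path_prob_nonneg split: prod.split)

lemma sub_invariant_le_safe_value:
  fixes C :: "'s::finite dtmc" and A :: "('q::finite, 's) buchi"
  assumes C: "is_dtmc C" and unamb: "unambiguous_from A (snd p\<^sub>0)"
    and empty: "\<And>D. D \<in> sccs (product_matrix C A) \<Longrightarrow> (\<And>p. p \<in> D \<Longrightarrow> language A (snd p) = {}) \<Longrightarrow>
      spectral_radius (submatrix_on (product_matrix C A) D) \<le> 1"
    and normalizer: "\<And>D. D \<in> recurrent_sccs (product_matrix C A) \<Longrightarrow> normalizer C A D (\<mu> D)"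
    and x: "\<And>p. 0 \<le> x p" "\<And>p. x p \<le> (\<Sum>p'\<in>UNIV. product_matrix C A p p' * x p')"
      "\<And>D. D \<in> recurrent_sccs (product_matrix C A) \<Longrightarrow> (\<Sum>p\<in>D. \<mu> D p * x p) \<le> 1"
      "state_supp x \<subseteq> S'"
  shows "x p\<^sub>0 \<le> safe_value C A S' p\<^sub>0"
proof (rule ccontr)
  assume contr: "\<not> x p\<^sub>0 \<le> safe_value C A S' p\<^sub>0"
  let ?B = "product_matrix C A" and ?V = "value_vec C A" and ?W = "safe_value C A S'"
  let ?E = "(edges ?B)\<^sup>*"
  note nonneg = product_matrix_nonneg[OF C, of A]
  \<comment> \<open>Truncated to the states reachable from \<open>p\<^sub>0\<close>, where
    unambiguity gives the equation for \<open>?W\<close>. No edge leaves this set, so the truncation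
    costs nothing in \<open>B y\<close>.\<close>
  define y where "y p = (if (p\<^sub>0, p) \<in> ?E then max 0 (x p - ?W p) else 0)" for p
  have unamb_reach: "unambiguous_from A (snd p)" if "(p\<^sub>0, p) \<in> ?E" for p
    using unambiguous_from_rtrancl[OF that unamb] .
  have x_supp: "x p = 0" if "fst p \<notin> S'" for p
    using x(1)[of p] x(4) that by (cases p) (fastforce simp: state_supp_def less_le)
  have W_nonneg: "0 \<le> ?W p" for p
    by (simp add: safe_value_def path_prob_nonneg split: prod.split)
  have y_nonneg: "0 \<le> y p" for p
    by (simp add: y_def)
  have y_sub: "y p \<le> (\<Sum>p'\<in>UNIV. ?B p p' * y p')" for p
  proof (cases "0 < y p")
    case True
    then have reach: "(p\<^sub>0, p) \<in> ?E" and yp: "y p = x p - ?W p"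
      by (auto simp: y_def split: if_splits)
    have "fst p \<in> S'"
      using True yp x_supp[of p] W_nonneg[of p] by fastforce
    then have "?W p = (\<Sum>p'\<in>UNIV. ?B p p' * ?W p')"
      using safe_value_step(2)[OF C _ unamb_reach[OF reach]] by blast
    then have "y p \<le> (\<Sum>p'\<in>UNIV. ?B p p' * (x p' - ?W p'))"
      using x(2)[of p] by (simp add: yp right_diff_distrib sum_subtractf)
    also have "\<dots> \<le> (\<Sum>p'\<in>UNIV. ?B p p' * y p')"
    proof (rule sum_mono)
      fix p'
      show "?B p p' * (x p' - ?W p') \<le> ?B p p' * y p'"
      proof (cases "?B p p' = 0")
        case False
        then have "(p, p') \<in> edges ?B"
          using nonneg[of p p'] by (simp add: edges_def less_le)
        with reach have "(p\<^sub>0, p') \<in> ?E"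
          by (rule rtrancl_into_rtrancl)
        then show ?thesis
          using nonneg by (intro mult_left_mono) (simp_all add: y_def)
      qed simp
    qed
    finally show ?thesis .
  next
    case False
    then have "y p = 0"
      using y_nonneg[of p] by simp
    moreover have "0 \<le> (\<Sum>p'\<in>UNIV. ?B p p' * y p')"
      by (intro sum_nonneg mult_nonneg_nonneg nonneg y_nonneg)
    ultimately show ?thesis
      by simp
  qed
  have "0 < y p\<^sub>0"
    using contr by (simp add: y_def)
  from minimal_support_scc[OF nonneg y_nonneg y_sub this]
  obtain D p where D: "D \<in> sccs ?B" "p \<in> D" "0 < y p" and y_D: "\<And>p. p \<in> D \<Longrightarrow> y p \<le> restr_op ?B D y p"
    by blast
  have "(p\<^sub>0, p) \<in> ?E"
    using D(3) by (simp add: y_def split: if_splits)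
  have D_conn: "(p, p') \<in> ?E" if "p \<in> D" "p' \<in> D" for p p'
    using rtrancl_scc[OF D(1) that] rtrancl_mono[of "edges ?B \<inter> D \<times> D" "edges ?B"] by blast
  then have D_reach: "(p\<^sub>0, p') \<in> ?E" if "p' \<in> D" for p'
    using \<open>(p\<^sub>0, p) \<in> ?E\<close> D(2) that by (blast intro: rtrancl_trans)
  \<comment> \<open>If all languages on \<open>D\<close> are empty there is no word to graft, and
    the hypothesis \<open>empty\<close> takes over.\<close>
  have "spectral_radius (submatrix_on ?B D) \<le> 1"
  proof (cases "\<forall>p\<in>D. language A (snd p) = {}")
    case True
    then show ?thesis
      by (intro empty D(1)) blast
  next
    case False
    then have "language A (snd p) \<noteq> {}" if "p \<in> D" for p
      using language_nonempty_rtrancl[OF D_conn[OF that]] by blast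
    then show ?thesis
      using D(2) D_reach unamb_reach by (intro spectral_radius_product_matrix_le_1[OF C]) blast+
  qed
  moreover have "1 \<le> spectral_radius (submatrix_on ?B D)"
    using D by (intro spectral_radius_ge_1[OF _ nonneg y_D]) auto
  ultimately have rec: "D \<in> recurrent_sccs ?B"
    using D(1) by (simp add: recurrent_sccs_def)
  note \<mu> = normalizer[OF rec, unfolded normalizer_def]
  \<comment> \<open>An SCC on which the value vanishes has no normalizer, so it is excluded
    here.\<close>
  have "\<exists>p\<in>D. 0 < \<mu> D p * ?V p"
  proof (rule ccontr)
    assume "\<not> ?thesis"
    then have "(\<Sum>p\<in>D. \<mu> D p * ?V p) \<le> 0"
      by (intro sum_nonpos) (auto simp: not_less)
    with \<mu> show False
      by simp
  qed
  then obtain p\<^sub>1 where p\<^sub>1: "p\<^sub>1 \<in> D" "0 < \<mu> D p\<^sub>1 * ?V p\<^sub>1"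
    by blast
  then have p\<^sub>1_pos: "0 < ?V p\<^sub>1" "0 < \<mu> D p\<^sub>1"
    using value_vec_nonneg[of C A p\<^sub>1] \<mu> by (auto simp: zero_less_mult_iff)
  have V_sub: "restr_op ?B D ?V p \<le> ?V p" if "p \<in> D" for p
    unfolding restr_op_def value_vec_step[OF C unamb_reach[OF D_reach[OF that]]]
    by (intro sum_mono2 mult_nonneg_nonneg nonneg value_vec_nonneg) simp_all
  have V_pos: "0 < ?V p" if "p \<in> D" for p
    using positive_on_scc[OF _ D(1) nonneg value_vec_nonneg V_sub p\<^sub>1(1) p\<^sub>1_pos(1) that] by simp
  obtain c where c: "0 < c" "\<And>p. p \<in> D \<Longrightarrow> y p = c * ?V p" "\<And>p. p \<in> D \<Longrightarrow> restr_op ?B D ?V p = ?V p"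
    using sub_super_invariant_proportional[OF _ D(1) nonneg V_pos V_sub y_D D(2,3)] by auto
  have y_pos: "0 < y p" "y p = x p - ?W p" if "p \<in> D" for p
  proof -
    show "0 < y p"
      using c V_pos that by simp
    then show "y p = x p - ?W p"
      by (auto simp: y_def split: if_splits)
  qed
  have "fst ` D \<subseteq> S'"
  proof (rule image_subsetI, rule ccontr)
    fix p assume p: "p \<in> D" "fst p \<notin> S'"
    show False
      using y_pos[OF p(1)] x_supp[OF p(2)] W_nonneg[of p] by simp
  qed
  then have W: "?W p = ?V p" if "p \<in> D" for p
    using that by (intro safe_value_eq_value_vec[OF C _ unamb_reach[OF D_reach] c(3)])
  have "(\<Sum>p\<in>D. \<mu> D p * x p) = (\<Sum>p\<in>D. (1 + c) * (\<mu> D p * ?V p))"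
  proof (rule sum.cong)
    fix p assume p: "p \<in> D"
    have "x p = (1 + c) * ?V p"
      using y_pos(2)[OF p] c(2)[OF p] W[OF p] by (simp add: algebra_simps)
    then show "\<mu> D p * x p = (1 + c) * (\<mu> D p * ?V p)"
      by simp
  qed simp
  also have "\<dots> = 1 + c"
    using \<mu> by (simp add: sum_distrib_left[symmetric])
  finally show False
    using x(3)[OF rec] c(1) by simp
qed

theorem theorem5:
  fixes C :: "'s::finite dtmc"
    and A :: "('q::finite, 's) buchi"
    and \<phi> :: "(nat \<Rightarrow> 's) set"
    and \<mu> :: "('s \<times> 'q) set \<Rightarrow> 's \<times> 'q \<Rightarrow> real"
    and Dplus :: "('s \<times> 'q) set set"
    and \<theta> :: real
    and S' :: "'s set"
  assumes "is_dtmc C"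
    and "unambiguous A"
    and "\<phi> = language A (buchi_init A)"
    and "\<forall>D\<in>sccs (product_matrix C A). (\<forall>(s, q)\<in>D. language A q = {}) \<longrightarrow>
           spectral_radius (submatrix_on (product_matrix C A) D) \<le> 1"
    and "\<forall>D\<in>recurrent_sccs (product_matrix C A). accepting_set A D"
    and "Dplus = {D \<in> recurrent_sccs (product_matrix C A). accepting_set A D}"
    and "\<forall>D\<in>Dplus. normalizer C A D (\<mu> D)"
    and "0 \<le> \<theta>" and "\<theta> \<le> 1"
  shows "satisfies_prob_ge (restrict_dtmc C S') \<theta> \<phi> \<longleftrightarrow>
    (\<exists>x :: 's \<times> 'q \<Rightarrow> real.
       (\<forall>p. 0 \<le> x p \<and> x p \<le> 1) \<and>
       (\<forall>p. (\<Sum>p'\<in>UNIV. product_matrix C A p p' * x p') \<ge> x p) \<and>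
       (\<forall>D\<in>Dplus. (\<Sum>p\<in>D. \<mu> D p * x p) \<le> 1) \<and>
       x (dtmc_init C, buchi_init A) \<ge> \<theta> \<and>
       state_supp x \<subseteq> S')"
proof -
  note C = \<open>is_dtmc C\<close>
  let ?p = "(dtmc_init C, buchi_init A)" and ?W = "safe_value C A S'"
  \<comment> \<open>With no non-accepting recurrent SCCs, the normalizer constraints cover every
    recurrent SCC, whichever one the minimality argument finds.\<close>
  have Dplus: "Dplus = recurrent_sccs (product_matrix C A)"
    using assms(5,6) by blast
  have "dtmc_init (restrict_dtmc C S') = dtmc_init C"
    by (simp add: restrict_dtmc_def)
  then have "satisfies_prob_ge (restrict_dtmc C S') \<theta> \<phi> \<longleftrightarrow> \<theta> \<le> ?W ?p"
    by (simp add: satisfies_prob_ge_def assms(3) safe_value_restrict_dtmc[OF C])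
  also have "\<dots> \<longleftrightarrow> (\<exists>x :: 's \<times> 'q \<Rightarrow> real. (\<forall>p. 0 \<le> x p \<and> x p \<le> 1) \<and>
       (\<forall>p. (\<Sum>p'\<in>UNIV. product_matrix C A p p' * x p') \<ge> x p) \<and>
       (\<forall>D\<in>Dplus. (\<Sum>p\<in>D. \<mu> D p * x p) \<le> 1) \<and> x ?p \<ge> \<theta> \<and> state_supp x \<subseteq> S')"
  proof
    assume "\<theta> \<le> ?W ?p"
    moreover have "0 \<le> ?W p \<and> ?W p \<le> 1" for p
      by (simp add: safe_value_def path_prob_nonneg path_prob_le_1 split: prod.split)
    moreover have "(\<Sum>p\<in>D. \<mu> D p * ?W p) \<le> 1" if "D \<in> Dplus" for D
    proof -
      have \<mu>: "\<And>p. p \<in> D \<Longrightarrow> 0 \<le> \<mu> D p" "(\<Sum>p\<in>D. \<mu> D p * value_vec C A p) = 1"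
        using assms(7) that by (auto simp: normalizer_def)
      have "(\<Sum>p\<in>D. \<mu> D p * ?W p) \<le> (\<Sum>p\<in>D. \<mu> D p * value_vec C A p)"
        by (intro sum_mono mult_left_mono safe_value_le_value_vec \<mu>)
      with \<mu>(2) show ?thesis
        by simp
    qed
    moreover have "state_supp ?W \<subseteq> S'"
    proof
      fix s assume "s \<in> state_supp ?W"
      then obtain q where "0 < ?W (s, q)"
        by (auto simp: state_supp_def)
      then show "s \<in> S'"
        using safe_value_outside[OF C, of s S' A q] by (cases "s \<in> S'") simp_all
    qed
    ultimately show "\<exists>x. (\<forall>p. 0 \<le> x p \<and> x p \<le> 1) \<and>
       (\<forall>p. (\<Sum>p'\<in>UNIV. product_matrix C A p p' * x p') \<ge> x p) \<and>
       (\<forall>D\<in>Dplus. (\<Sum>p\<in>D. \<mu> D p * x p) \<le> 1) \<and> x ?p \<ge> \<theta> \<and> state_supp x \<subseteq> S'"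
      using safe_value_step(1)[OF C, of A S'] by (intro exI[of _ ?W]) blast
  next
    assume "\<exists>x. (\<forall>p. 0 \<le> x p \<and> x p \<le> 1) \<and>
       (\<forall>p. (\<Sum>p'\<in>UNIV. product_matrix C A p p' * x p') \<ge> x p) \<and>
       (\<forall>D\<in>Dplus. (\<Sum>p\<in>D. \<mu> D p * x p) \<le> 1) \<and> x ?p \<ge> \<theta> \<and> state_supp x \<subseteq> S'"
    then obtain x where x: "\<And>p. 0 \<le> x p" "\<And>p. x p \<le> (\<Sum>p'\<in>UNIV. product_matrix C A p p' * x p')"
      "\<And>D. D \<in> Dplus \<Longrightarrow> (\<Sum>p\<in>D. \<mu> D p * x p) \<le> 1" "state_supp x \<subseteq> S'" and \<theta>: "\<theta> \<le> x ?p"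
      by blast
    have "x ?p \<le> ?W ?p"
    proof (rule sub_invariant_le_safe_value[OF C _ _ _ x(1,2) _ x(4)])
      show "unambiguous_from A (snd ?p)"
        using assms(2) by (simp add: unambiguous_def unambiguous_from_def)
      show "normalizer C A D (\<mu> D)" if "D \<in> recurrent_sccs (product_matrix C A)" for D
        using that assms(7) Dplus by blast
      show "(\<Sum>p\<in>D. \<mu> D p * x p) \<le> 1" if "D \<in> recurrent_sccs (product_matrix C A)" for D
        using that x(3) Dplus by blast
      show "spectral_radius (submatrix_on (product_matrix C A) D) \<le> 1"
        if "D \<in> sccs (product_matrix C A)" "\<And>p. p \<in> D \<Longrightarrow> language A (snd p) = {}" for D
        using assms(4) that by fastforce
    qed
    with \<theta> show "\<theta> \<le> ?W ?p"
      by simp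
  qed
  finally show ?thesis .
qed

end
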